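(* Let $\delta\in(0,1)$ and $N\geq n_x+n_u$. Then with probability at least $1-\delta$, both $$\|\hat A-A\|_2\leq C\,\|Q_AMQ_A^\top\|_2^{1/2}\qquad\text{and}\qquad\|\hat B-B\|_2\leq C\,\|Q_BMQ_B^\top\|_2^{1/2}$$ hold, where $C=\sigma_w\big(\sqrt{n_x+n_u}+\sqrt{n_x}+\sqrt{2\log(1/\delta)}\big)$.
   Context: Let $A\in\mathbb{R}^{n_x\times n_x}$, $B\in\mathbb{R}^{n_x\times n_u}$ and $\sigma_w>0$. One observes $N$ independent samples $(y^{(\ell)},x^{(\ell)},u^{(\ell)})\in\mathbb{R}^{n_x}\times\mathbb{R}^{n_x}\times\mathbb{R}^{n_u}$, $\ell=1,\dots,N$, with $$y^{(\ell)}=Ax^{(\ell)}+Bu^{(\ell)}+w^{(\ell)},$$ where the $w^{(\ell)}$ are i.i.d. $\mathcal{N}(0,\sigma_w^2I_{n_x})$ and independent of the $x^{(\ell)}$ and $u^{(\ell)}$. The estimate $(\hat A,\hat B)$ is a minimizer of the ordinary least-squares objective $\sum_{\ell=1}^N\|y^{(\ell)}-A'x^{(\ell)}-B'u^{(\ell)}\|_2^2$ over $(A',B')$. Define $$M:=\left(\sum_{\ell=1}^N\begin{bmatrix} x^{(\ell)} \\ u^{(\ell)} \end{bmatrix}\begin{bmatrix} x^{(\ell)} \\ u^{(\ell)} \end{bmatrix}^\top\right)^{-1},\quad Q_A:=\begin{bmatrix}I_{n_x}&0_{n_x\times n_u}\end{bmatrix},\quad Q_B:=\begin{bmatrix}0_{n_u\times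 n_x}&I_{n_u}\end{bmatrix}.$$ If the matrix being inverted in the definition of $M$ is singular, the right-hand sides of the bounds are interpreted as $+\infty$. $\|\cdot\|_2$ on matrices is the spectral norm and $\log$ is the natural logarithm. *)

theory Defs
  imports "HOL-Probability.Probability"
begin

text \<open>Matrices of type \<^typ>\<open>real^'n^'m\<close> have rows indexed by \<open>'m\<close> and columns indexed by
  \<open>'n\<close>; their type class norm is the Frobenius norm, hence the separate spectral norm.
  A vector or matrix stacked from blocks of sizes \<open>CARD('a)\<close> and \<open>CARD('b)\<close> is indexed by the
  sum type \<open>'a + 'b\<close>.\<close>

definition spectral_norm :: "real^'n^'m \<Rightarrow> real" where
  "spectral_norm X = onorm (\<lambda>v. X *v v)"

definition vstack :: "real^'a \<Rightarrow> real^'b \<Rightarrow> real^('a + 'b)" where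
  "vstack x u = (\<chi> k. case k of Inl i \<Rightarrow> x $ i | Inr j \<Rightarrow> u $ j)"

definition hstack :: "real^'a^'m \<Rightarrow> real^'b^'m \<Rightarrow> real^('a + 'b)^'m" where
  "hstack X Y = (\<chi> r. vstack (X $ r) (Y $ r))"

definition Q\<^sub>A :: "real^('a::finite + 'b::finite)^'a" where
  "Q\<^sub>A = hstack (mat 1) 0"

definition Q\<^sub>B :: "real^('a::finite + 'b::finite)^'b" where
  "Q\<^sub>B = hstack 0 (mat 1)"

definition gram :: "nat \<Rightarrow> (nat \<Rightarrow> real^'a) \<Rightarrow> (nat \<Rightarrow> real^'b) \<Rightarrow> real^('a + 'b)^('a + 'b)" where
  "gram N x u =
     (\<Sum>l = 1..N. let z = vstack (x l) (u l) in (columnvector z :: real^1^('a + 'b)) ** rowvector z)"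

definition ols_objective ::
  "nat \<Rightarrow> (nat \<Rightarrow> real^'a) \<Rightarrow> (nat \<Rightarrow> real^'a) \<Rightarrow> (nat \<Rightarrow> real^'b)
    \<Rightarrow> (real^'a^'a) \<times> (real^'b^'a) \<Rightarrow> real" where
  "ols_objective N y x u = (\<lambda>(A', B'). \<Sum>l = 1..N. (norm (y l - A' *v x l - B' *v u l))\<^sup>2)"

text \<open>The library's \<open>indep_var\<close> forces both random variables to have the same value type.\<close>

definition indep_rvs ::
  "'w measure \<Rightarrow> 'c measure \<Rightarrow> ('w \<Rightarrow> 'c) \<Rightarrow> 'd measure \<Rightarrow> ('w \<Rightarrow> 'd) \<Rightarrow> bool" where
  "indep_rvs P S X T Y \<longleftrightarrow>
     X \<in> measurable P S \<and> Y \<in> measurable P T \<and>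
     prob_space.indep_set P {X -` E \<inter> space P |E. E \<in> sets S} {Y -` F \<inter> space P |F. F \<in> sets T}"

text \<open>The value is the usual Lebesgue density of the normal distribution only if the covariance matrix
  \<open>\<Sigma>\<close> is symmetric and positive definite.\<close>

definition mv_normal_density :: "real^'n \<Rightarrow> real^'n^'n \<Rightarrow> real^'n \<Rightarrow> real" where
  "mv_normal_density \<mu> \<Sigma> v =
     exp (- ((v - \<mu>) \<bullet> (matrix_inv \<Sigma> *v (v - \<mu>))) / 2) / sqrt ((2 * pi) ^ CARD('n) * det \<Sigma>)"

text \<open>\<open>c * \<parallel>Q G\<^sup>-\<^sup>1 Q\<^sup>T\<parallel>\<^sup>1\<^sup>/\<^sup>2\<close>, read as \<open>\<infinity>\<close> if \<open>G\<close> is singular.\<close>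

definition error_bound :: "real \<Rightarrow> real^'k^'m \<Rightarrow> real^'k^'k \<Rightarrow> ereal" where
  "error_bound c Q G =
     (if invertible G then ereal (c * sqrt (spectral_norm (Q ** matrix_inv G ** transpose Q)))
      else \<infinity>)"

end

theory Submission
  imports Defs
begin

text \<open>By the normal equations the estimation error \<open>E = [A' - A, B' - B]\<close> satisfies
  \<open>E (G q) = \<Sum>l. \<langle>z\<^sub>l, q\<rangle> w\<^sub>l\<close> for the Gram matrix \<open>G\<close> of the regressors \<open>z\<^sub>l\<close>, so both bounds follow once
  \<open>\<parallel>\<Sum>l. \<langle>z\<^sub>l, q\<rangle> w\<^sub>l\<parallel> \<le> C (\<Sum>l. \<langle>z\<^sub>l, q\<rangle>\<^sup>2)\<^sup>1\<^sup>/\<^sup>2\<close> holds for all \<open>q\<close>. For fixed regressors this bounds the norm of a Gaussian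
  matrix with \<open>n\<^sub>x\<close> rows and at most \<open>k = n\<^sub>x + n\<^sub>u\<close> columns. For unit vectors, Slepian's inequality
  compares \<open>\<langle>v, W q\<rangle> + \<gamma>\<close>, with an independent standard normal \<open>\<gamma>\<close>, to \<open>\<langle>g, q\<rangle> + \<langle>h, v\<rangle>\<close> with independent
  Gaussian vectors \<open>g\<close> and \<open>h\<close>: the variances agree and the covariances differ by
  \<open>(1 - \<langle>q, q'\<rangle>) (1 - \<langle>v, v'\<rangle>) \<ge> 0\<close>. Comparing exponential moments and dividing by that of \<open>\<gamma>\<close> gives
  \<open>E exp (t \<parallel>W\<parallel>) \<le> exp (t (\<surd>k + \<surd>n\<^sub>x) + t\<^sup>2 / 2)\<close>, and Markov's inequality yields the sharp tail without a
  separate concentration theorem.\<close>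

section \<open>Gaussian integration by parts\<close>

definition std_gauss :: "real measure" where
  "std_gauss = density lborel std_normal_density"

lemma prob_space_std_gauss: "prob_space std_gauss"
  unfolding std_gauss_def by (rule prob_space_normal_density) simp

lemma sets_std_gauss [simp, measurable_cong]: "sets std_gauss = sets borel"
  by (simp add: std_gauss_def)

lemma space_std_gauss [simp]: "space std_gauss = UNIV"
  by (simp add: std_gauss_def)

lemma product_prob_space_std_gauss: "product_prob_space (\<lambda>_. std_gauss)"
  by (intro product_prob_spaceI prob_space_std_gauss)

lemma integrable_std_gauss_id: "integrable std_gauss (\<lambda>y. y)"
  using integrable_std_normal_moment[of 1]
  by (simp add: std_gauss_def integrable_density)

text \<open>The standard normal density satisfies \<phi>' = - y \<phi>, so \<phi> (F' - y F) is the
  derivative of \<phi> F, which tends to 0 at both ends; its integral over the line therefore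
  vanishes. Boundedness supplies integrability and the limits.\<close>

lemma std_gauss_ibp:
  fixes F F' :: "real \<Rightarrow> real"
  assumes deriv: "\<And>y. (F has_real_derivative F' y) (at y)"
    and cont: "continuous_on UNIV F'"
    and bF: "\<And>y. \<bar>F y\<bar> \<le> B" and bF': "\<And>y. \<bar>F' y\<bar> \<le> B"
  shows "(\<integral>y. y * F y \<partial>std_gauss) = (\<integral>y. F' y \<partial>std_gauss)"
proof -
  interpret prob_space std_gauss by (rule prob_space_std_gauss)
  have contF: "continuous_on UNIV F"
    using deriv by (meson DERIV_isCont continuous_at_imp_continuous_on)
  have [measurable]: "F \<in> borel_measurable borel" "F' \<in> borel_measurable borel"
    using contF cont by (auto intro: borel_measurable_continuous_onI)
  have int1: "integrable std_gauss F'"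
    by (rule integrable_const_bound[where B=B]) (use bF' in auto)
  have int2: "integrable std_gauss (\<lambda>y. y * F y)"
    by (rule Bochner_Integration.integrable_bound[OF integrable_mult_right[OF integrable_std_gauss_id, of B]])
      (use bF order.trans[OF abs_ge_zero bF] in \<open>auto simp: abs_mult mult.commute[of B] intro!: AE_I2 mult_left_mono\<close>)
  define G g where "G y = std_normal_density y * F y"
    and "g y = std_normal_density y * (F' y - y * F y)" for y
  have dens: "(std_normal_density has_real_derivative - y * std_normal_density y) (at y)" for y
    unfolding std_normal_density_def
    by (auto intro!: derivative_eq_intros simp: field_simps)
  have G: "(G has_real_derivative g y) (at y)" for y
    unfolding G_def g_def
    by (rule DERIV_cong[OF DERIV_mult[OF dens deriv]]) (simp add: algebra_simps)
  have int: "integrable lborel g"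
    using Bochner_Integration.integrable_diff[OF int1 int2]
    by (simp add: std_gauss_def integrable_density g_def[abs_def])
  have "continuous_on UNIV std_normal_density"
    unfolding std_normal_density_def by (intro continuous_intros) auto
  hence contg: "continuous_on UNIV g"
    unfolding g_def by (intro continuous_intros cont contF)
  have lim0: "(std_normal_density \<longlongrightarrow> 0) at_top" "(std_normal_density \<longlongrightarrow> 0) at_bot"
    unfolding std_normal_density_def by real_asymp+
  have *: "(G \<longlongrightarrow> 0) F0" if "(std_normal_density \<longlongrightarrow> 0) F0" for F0
  proof (rule Lim_null_comparison)
    show "\<forall>\<^sub>F y in F0. norm (G y) \<le> B * std_normal_density y"
      using bF by (auto simp: G_def abs_mult mult.commute[of B] intro!: mult_left_mono always_eventually)
    show "((\<lambda>y. B * std_normal_density y) \<longlongrightarrow> 0) F0"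
      using tendsto_mult_right_zero[OF that] by simp
  qed
  have "(LBINT y=-\<infinity>..\<infinity>. g y) = 0 - 0"
    by (rule interval_integral_FTC_integrable[where F=G])
      (use G contg int *[OF lim0(1)] *[OF lim0(2)] in
       \<open>auto simp: has_real_derivative_iff_has_vector_derivative ereal_tendsto_simps
          continuous_on_eq_continuous_at set_integrable_def\<close>)
  hence "(\<integral>y. g y \<partial>lborel) = 0"
    by (simp add: interval_lebesgue_integral_def set_lebesgue_integral_def)
  hence "(\<integral>y. F' y - y * F y \<partial>std_gauss) = 0"
    by (simp add: std_gauss_def integral_density g_def)
  thus ?thesis using int1 int2 by simp
qed

lemma integrable_std_gauss_component:
  assumes "finite K" "k \<in> K"
  shows "integrable (Pi\<^sub>M K (\<lambda>_. std_gauss)) (\<lambda>x. x k)"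
proof -
  interpret product_prob_space "\<lambda>_. std_gauss" K by (rule product_prob_space_std_gauss)
  have "integrable (distr (Pi\<^sub>M K (\<lambda>_. std_gauss)) std_gauss (\<lambda>x. x k)) (\<lambda>y. y)"
    using integrable_std_gauss_id PiM_component[OF assms(2)] by simp
  thus ?thesis using assms by (subst (asm) integrable_distr_eq) auto
qed

text \<open>Fubini isolates coordinate \<open>k\<close>; with the other coordinates frozen, the
  one-dimensional identity applies.\<close>

lemma PiM_std_gauss_ibp:
  fixes F F' :: "('k \<Rightarrow> real) \<Rightarrow> real"
  assumes K: "finite K" "k \<in> K"
    and meas[measurable]: "F \<in> borel_measurable (Pi\<^sub>M K (\<lambda>_. std_gauss))"
      "F' \<in> borel_measurable (Pi\<^sub>M K (\<lambda>_. std_gauss))"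
    and deriv: "\<And>x y. ((\<lambda>y. F (x(k := y))) has_real_derivative F' (x(k := y))) (at y)"
    and cont: "\<And>x. continuous_on UNIV (\<lambda>y. F' (x(k := y)))"
    and bF: "\<And>x. \<bar>F x\<bar> \<le> B" and bF': "\<And>x. \<bar>F' x\<bar> \<le> B"
  shows "integrable (Pi\<^sub>M K (\<lambda>_. std_gauss)) (\<lambda>x. x k * F x)"
    and "(\<integral>x. x k * F x \<partial>Pi\<^sub>M K (\<lambda>_. std_gauss)) = (\<integral>x. F' x \<partial>Pi\<^sub>M K (\<lambda>_. std_gauss))"
proof -
  interpret product_prob_space "\<lambda>_::'k. std_gauss" K by (rule product_prob_space_std_gauss)
  have K': "K = insert k (K - {k})" using K by auto
  have [measurable]: "(\<lambda>x. x k) \<in> borel_measurable (Pi\<^sub>M K (\<lambda>_. std_gauss))"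
    using integrable_std_gauss_component[OF K] by auto
  show int2: "integrable (Pi\<^sub>M K (\<lambda>_. std_gauss)) (\<lambda>x. x k * F x)"
    by (rule Bochner_Integration.integrable_bound[OF integrable_mult_right[OF integrable_std_gauss_component[OF K], of B]])
      (use bF order.trans[OF abs_ge_zero bF] in \<open>auto simp: abs_mult mult.commute[of B] intro!: AE_I2 mult_left_mono\<close>)
  have int1: "integrable (Pi\<^sub>M K (\<lambda>_. std_gauss)) F'"
    by (rule P.integrable_const_bound[where B=B]) (use bF' in auto)
  have "(\<integral>x. x k * F x \<partial>Pi\<^sub>M K (\<lambda>_. std_gauss))
      = (\<integral>x. (\<integral>y. y * F (x(k := y)) \<partial>std_gauss) \<partial>Pi\<^sub>M (K - {k}) (\<lambda>_. std_gauss))"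
    using product_integral_insert[of "K - {k}" k "\<lambda>x. x k * F x"] K int2 K' by simp
  also have "\<dots> = (\<integral>x. (\<integral>y. F' (x(k := y)) \<partial>std_gauss) \<partial>Pi\<^sub>M (K - {k}) (\<lambda>_. std_gauss))"
    by (intro Bochner_Integration.integral_cong refl std_gauss_ibp[where B=B] deriv cont bF bF')
  also have "\<dots> = (\<integral>x. F' x \<partial>Pi\<^sub>M K (\<lambda>_. std_gauss))"
    using product_integral_insert[of "K - {k}" k F'] K int1 K' by simp
  finally show "(\<integral>x. x k * F x \<partial>Pi\<^sub>M K (\<lambda>_. std_gauss)) = (\<integral>x. F' x \<partial>Pi\<^sub>M K (\<lambda>_. std_gauss))" .
qed

section \<open>Slepian's inequality\<close>

text \<open>The processes are interpolated as \<open>cos \<theta> b\<^sub>i + sin \<theta> a\<^sub>i\<close>. By Gaussian integration by parts the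
  derivative in \<open>\<theta>\<close> only involves mixed derivatives of the test function \<open>\<Prod>i. \<psi> (z\<^sub>i)\<close>, and these are
  nonnegative because \<open>\<psi>\<close> is decreasing.\<close>

lemma slepian_smooth:
  fixes a b :: "'i \<Rightarrow> 'k \<Rightarrow> real" and \<psi> \<psi>' \<psi>'' :: "real \<Rightarrow> real"
  assumes fin: "finite I" "finite K"
    and orth: "\<And>i j. i \<in> I \<Longrightarrow> j \<in> I \<Longrightarrow> (\<Sum>k\<in>K. a i k * b j k) = 0"
    and var: "\<And>i. i \<in> I \<Longrightarrow> (\<Sum>k\<in>K. a i k * a i k) = (\<Sum>k\<in>K. b i k * b i k)"
    and cov: "\<And>i j. i \<in> I \<Longrightarrow> j \<in> I \<Longrightarrow> (\<Sum>k\<in>K. b i k * b j k) \<le> (\<Sum>k\<in>K. a i k * a j k)"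
    and d1: "\<And>t. (\<psi> has_real_derivative \<psi>' t) (at t)"
    and d2: "\<And>t. (\<psi>' has_real_derivative \<psi>'' t) (at t)"
    and cont2: "continuous_on UNIV \<psi>''"
    and range: "\<And>t. 0 \<le> \<psi> t" "\<And>t. \<psi> t \<le> 1" and decr: "\<And>t. \<psi>' t \<le> 0"
    and b1: "\<And>t. \<bar>\<psi>' t\<bar> \<le> B" and b2: "\<And>t. \<bar>\<psi>'' t\<bar> \<le> B"
  shows "(\<integral>x. (\<Prod>i\<in>I. \<psi> (\<Sum>k\<in>K. b i k * x k)) \<partial>Pi\<^sub>M K (\<lambda>_. std_gauss))
       \<le> (\<integral>x. (\<Prod>i\<in>I. \<psi> (\<Sum>k\<in>K. a i k * x k)) \<partial>Pi\<^sub>M K (\<lambda>_. std_gauss))"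
proof -
  define \<mu> where "\<mu> = Pi\<^sub>M K (\<lambda>_::'k. std_gauss)"
  interpret product_prob_space "\<lambda>_::'k. std_gauss" K by (rule product_prob_space_std_gauss)
  interpret Mu: prob_space \<mu> unfolding \<mu>_def by (rule P.prob_space_axioms)
  interpret pair_sigma_finite lborel \<mu> ..
  have B: "0 \<le> B" using order.trans[OF abs_ge_zero b1] .
  have cont0: "continuous_on UNIV \<psi>" and cont1: "continuous_on UNIV \<psi>'"
    using d1 d2 by (meson DERIV_isCont continuous_at_imp_continuous_on)+
  have [measurable]: "\<psi> \<in> borel_measurable borel" "\<psi>' \<in> borel_measurable borel"
      "\<psi>'' \<in> borel_measurable borel"
    using cont0 cont1 cont2 by (auto intro: borel_measurable_continuous_onI)
  have [measurable]: "(\<lambda>x. x k) \<in> borel_measurable \<mu>" if "k \<in> K" for k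
    unfolding \<mu>_def using that integrable_std_gauss_component[OF fin(2)] by auto
  have prod1: "\<bar>\<Prod>j\<in>J. \<psi> (f j)\<bar> \<le> 1" for J :: "'i set" and f
    unfolding abs_prod by (rule prod_le_1) (use range in auto)
  have prod0: "0 \<le> (\<Prod>j\<in>J. \<psi> (f j))" for J :: "'i set" and f
    by (rule prod_nonneg) (use range in auto)
  \<comment> \<open>\<open>c \<theta> i\<close> is the coefficient vector of the interpolated
    process, equal to \<open>b i\<close> at 0 and to \<open>a i\<close> at \<open>pi/2\<close>;
    \<open>c'\<close> is its derivative in \<theta>. Cosine and sine keep the variances constant
    along the path.\<close>
  define c c' where "c \<theta> i k = cos \<theta> * b i k + sin \<theta> * a i k"
    and "c' \<theta> i k = cos \<theta> * a i k - sin \<theta> * b i k" for \<theta> i k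
  define Z where "Z \<theta> i x = (\<Sum>k\<in>K. c \<theta> i k * x k)" for \<theta> i and x :: "'k \<Rightarrow> real"
  \<comment> \<open>\<open>F\<close> is the partial derivative of the product test function in its
    \<open>i\<close>-th argument, and \<open>F'\<close> its derivative in the coordinate
    \<open>x k\<close>: the first summand differentiates \<psi>' again, the others a different
    factor.\<close>
  define F where "F \<theta> i x = \<psi>' (Z \<theta> i x) * (\<Prod>j\<in>I-{i}. \<psi> (Z \<theta> j x))" for \<theta> i x
  define F' where "F' \<theta> i k x = \<psi>'' (Z \<theta> i x) * c \<theta> i k * (\<Prod>j\<in>I-{i}. \<psi> (Z \<theta> j x))
    + \<psi>' (Z \<theta> i x) * (\<Sum>j\<in>I-{i}. \<psi>' (Z \<theta> j x) * c \<theta> j k * (\<Prod>l\<in>I-{i}-{j}. \<psi> (Z \<theta> l x)))"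
    for \<theta> i k x
  define \<Phi> \<Phi>' where "\<Phi> \<theta> x = (\<Prod>i\<in>I. \<psi> (Z \<theta> i x))"
    and "\<Phi>' \<theta> x = (\<Sum>i\<in>I. \<Sum>k\<in>K. c' \<theta> i k * (x k * F \<theta> i x))" for \<theta> x
  have Zm[measurable]: "(\<lambda>p. Z (fst p) i (snd p)) \<in> borel_measurable (lborel \<Otimes>\<^sub>M \<mu>)"
      "Z \<theta> i \<in> borel_measurable \<mu>" for i \<theta>
    unfolding Z_def c_def by measurable
  have Fm[measurable]: "(\<lambda>p. F (fst p) i (snd p)) \<in> borel_measurable (lborel \<Otimes>\<^sub>M \<mu>)"
      "F \<theta> i \<in> borel_measurable \<mu>" "F' \<theta> i k \<in> borel_measurable \<mu>" for i \<theta> k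
    unfolding F_def F'_def by measurable
  have \<Phi>m[measurable]: "(\<lambda>p. \<Phi>' (fst p) (snd p)) \<in> borel_measurable (lborel \<Otimes>\<^sub>M \<mu>)"
      "\<Phi> \<theta> \<in> borel_measurable \<mu>" for \<theta>
    unfolding \<Phi>_def \<Phi>'_def c'_def by measurable

  have Fb: "\<bar>F \<theta> i x\<bar> \<le> B" for \<theta> i x
    unfolding F_def abs_mult using mult_mono[OF b1 prod1] B by fastforce
  have F'b: "\<bar>F' \<theta> i k x\<bar> \<le> B * \<bar>c \<theta> i k\<bar> + B * (\<Sum>j\<in>I-{i}. B * \<bar>c \<theta> j k\<bar>)" for \<theta> i k x
    unfolding F'_def
  proof (rule order.trans[OF abs_triangle_ineq add_mono])
    have "\<bar>\<psi>'' (Z \<theta> i x)\<bar> * \<bar>c \<theta> i k\<bar> * \<bar>\<Prod>j\<in>I-{i}. \<psi> (Z \<theta> j x)\<bar> \<le> (B * \<bar>c \<theta> i k\<bar>) * 1"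
      by (intro mult_mono b2 prod1 order.refl) (use B in auto)
    thus "\<bar>\<psi>'' (Z \<theta> i x) * c \<theta> i k * (\<Prod>j\<in>I-{i}. \<psi> (Z \<theta> j x))\<bar> \<le> B * \<bar>c \<theta> i k\<bar>"
      by (simp add: abs_mult)
    have "\<bar>\<Sum>j\<in>I-{i}. \<psi>' (Z \<theta> j x) * c \<theta> j k * (\<Prod>l\<in>I-{i}-{j}. \<psi> (Z \<theta> l x))\<bar>
        \<le> (\<Sum>j\<in>I-{i}. B * \<bar>c \<theta> j k\<bar>)"
    proof (rule order.trans[OF sum_abs sum_mono])
      fix j
      have "\<bar>\<psi>' (Z \<theta> j x)\<bar> * \<bar>c \<theta> j k\<bar> * \<bar>\<Prod>l\<in>I-{i}-{j}. \<psi> (Z \<theta> l x)\<bar> \<le> (B * \<bar>c \<theta> j k\<bar>) * 1"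
        by (intro mult_mono b1 prod1 order.refl) (use B in auto)
      thus "\<bar>\<psi>' (Z \<theta> j x) * c \<theta> j k * (\<Prod>l\<in>I-{i}-{j}. \<psi> (Z \<theta> l x))\<bar> \<le> B * \<bar>c \<theta> j k\<bar>"
        by (simp add: abs_mult)
    qed
    thus "\<bar>\<psi>' (Z \<theta> i x) * (\<Sum>j\<in>I-{i}. \<psi>' (Z \<theta> j x) * c \<theta> j k * (\<Prod>l\<in>I-{i}-{j}. \<psi> (Z \<theta> l x)))\<bar>
        \<le> B * (\<Sum>j\<in>I-{i}. B * \<bar>c \<theta> j k\<bar>)"
      unfolding abs_mult by (intro mult_mono b1) (use B in auto)
  qed

  have Zupd: "Z \<theta> i (x(k := t)) = c \<theta> i k * t + (\<Sum>m\<in>K-{k}. c \<theta> i m * x m)" if "k \<in> K" for \<theta> i x k t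
    unfolding Z_def using that fin(2) by (subst sum.remove[of _ k]) (auto intro!: sum.cong)
  have dZ: "((\<lambda>t. Z \<theta> i (x(k := t))) has_real_derivative c \<theta> i k) (at t)" if "k \<in> K" for \<theta> i x k t
    unfolding Zupd[OF that] by (auto intro!: derivative_eq_intros)
  have d\<psi>Z: "((\<lambda>t. \<psi> (Z \<theta> i (x(k := t)))) has_real_derivative \<psi>' (Z \<theta> i (x(k := t))) * c \<theta> i k) (at t)"
    if "k \<in> K" for \<theta> i x k t
    by (rule DERIV_chain2[OF d1 dZ[OF that]])
  have contZ: "continuous_on UNIV (\<lambda>t. Z \<theta> i (x(k := t)))" if "k \<in> K" for \<theta> i x k
    unfolding Zupd[OF that] by (intro continuous_intros)
  have ibp: "integrable \<mu> (\<lambda>x. x k * F \<theta> i x)" "(\<integral>x. x k * F \<theta> i x \<partial>\<mu>) = (\<integral>x. F' \<theta> i k x \<partial>\<mu>)"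
    if "k \<in> K" for \<theta> i k
  proof -
    note *[simp] = continuous_on_compose2[OF cont0 contZ[OF that]] continuous_on_compose2[OF cont1 contZ[OF that]]
      continuous_on_compose2[OF cont2 contZ[OF that]]
    have deriv: "((\<lambda>t. F \<theta> i (x(k := t))) has_real_derivative F' \<theta> i k (x(k := t))) (at t)" for x t
      unfolding F_def F'_def
      by (rule DERIV_cong[OF DERIV_mult[OF DERIV_chain2[OF d2 dZ[OF that]]
            has_field_derivative_prod[OF d\<psi>Z[OF that]]]]) (simp add: algebra_simps)
    have cont: "continuous_on UNIV (\<lambda>t. F' \<theta> i k (x(k := t)))" for x
      unfolding F'_def by (intro continuous_intros; simp)
    \<comment> \<open>Integration by parts asks for one bound on both \<open>F\<close> and
      \<open>F'\<close>, hence the sum of the two bounds.\<close>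
    define B' where "B' = B + (B * \<bar>c \<theta> i k\<bar> + B * (\<Sum>j\<in>I-{i}. B * \<bar>c \<theta> j k\<bar>))"
    have B'1: "\<bar>F \<theta> i x\<bar> \<le> B'" for x
      using Fb[of \<theta> i x] B unfolding B'_def
      by (smt (verit) abs_ge_zero mult_nonneg_nonneg sum_nonneg)
    have B'2: "\<bar>F' \<theta> i k x\<bar> \<le> B'" for x using F'b[of \<theta> i k x] B unfolding B'_def by linarith
    show "integrable \<mu> (\<lambda>x. x k * F \<theta> i x)" "(\<integral>x. x k * F \<theta> i x \<partial>\<mu>) = (\<integral>x. F' \<theta> i k x \<partial>\<mu>)"
      unfolding \<mu>_def
      by (rule PiM_std_gauss_ibp[OF fin(2) that _ _ deriv cont B'1 B'2];
          use Fm in \<open>simp add: \<mu>_def\<close>)+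
  qed
  have F'int: "integrable \<mu> (F' \<theta> i k)" for \<theta> i k
    by (rule Mu.integrable_const_bound[where B = "B * \<bar>c \<theta> i k\<bar> + B * (\<Sum>j\<in>I-{i}. B * \<bar>c \<theta> j k\<bar>)"])
      (use F'b in auto)

  \<comment> \<open>The covariance of the velocity of process \<open>i\<close> with the position of
    process \<open>j\<close>. Orthogonality removes the terms in the squares of sine and
    cosine.\<close>
  have inner: "(\<Sum>k\<in>K. c' \<theta> i k * c \<theta> j k)
      = sin \<theta> * cos \<theta> * ((\<Sum>k\<in>K. a i k * a j k) - (\<Sum>k\<in>K. b i k * b j k))"
    if "i \<in> I" "j \<in> I" for \<theta> i j
  proof -
    have "(\<Sum>k\<in>K. c' \<theta> i k * c \<theta> j k)
      = sin \<theta> * cos \<theta> * ((\<Sum>k\<in>K. a i k * a j k) - (\<Sum>k\<in>K. b i k * b j k))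
        + (cos \<theta>)\<^sup>2 * (\<Sum>k\<in>K. a i k * b j k) - (sin \<theta>)\<^sup>2 * (\<Sum>k\<in>K. a j k * b i k)"
      unfolding c_def c'_def sum_distrib_left right_diff_distrib sum_subtractf[symmetric] sum.distrib[symmetric]
      by (intro sum.cong refl) (simp add: algebra_simps power2_eq_square)
    thus ?thesis using orth that by simp
  qed
  have nonneg: "0 \<le> (\<integral>x. \<Phi>' \<theta> x \<partial>\<mu>)" if \<theta>: "\<theta> \<in> {0..pi/2}" for \<theta>
  proof -
    have sc: "0 \<le> sin \<theta> * cos \<theta>" using \<theta> by (auto intro!: mult_nonneg_nonneg sin_ge_zero cos_ge_zero)
    have "(\<integral>x. \<Phi>' \<theta> x \<partial>\<mu>) = (\<Sum>i\<in>I. \<Sum>k\<in>K. c' \<theta> i k * (\<integral>x. F' \<theta> i k x \<partial>\<mu>))"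
      unfolding \<Phi>'_def using ibp by (subst Bochner_Integration.integral_sum) auto
    also have "\<dots> = (\<Sum>i\<in>I. \<integral>x. (\<Sum>k\<in>K. c' \<theta> i k * F' \<theta> i k x) \<partial>\<mu>)"
      using F'int by (subst Bochner_Integration.integral_sum) auto
    also have "\<dots> \<ge> 0"
    proof (rule sum_nonneg, rule Bochner_Integration.integral_nonneg)
      fix i x assume i: "i \<in> I"
      have "(\<Sum>k\<in>K. c' \<theta> i k * F' \<theta> i k x)
        = (\<Sum>k\<in>K. c' \<theta> i k * c \<theta> i k) * (\<psi>'' (Z \<theta> i x) * (\<Prod>j\<in>I-{i}. \<psi> (Z \<theta> j x)))
        + (\<Sum>j\<in>I-{i}. (\<Sum>k\<in>K. c' \<theta> i k * c \<theta> j k) *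
            (\<psi>' (Z \<theta> i x) * \<psi>' (Z \<theta> j x) * (\<Prod>l\<in>I-{i}-{j}. \<psi> (Z \<theta> l x))))"
        unfolding F'_def sum_distrib_left sum_distrib_right sum.swap[of _ K "I-{i}"] distrib_left sum.distrib
        by (intro sum.cong refl arg_cong2[where f="(+)"]) (simp_all add: algebra_simps)
      also have "\<dots> = (\<Sum>j\<in>I-{i}. (\<Sum>k\<in>K. c' \<theta> i k * c \<theta> j k) *
            (\<psi>' (Z \<theta> i x) * \<psi>' (Z \<theta> j x) * (\<Prod>l\<in>I-{i}-{j}. \<psi> (Z \<theta> l x))))"
        \<comment> \<open>The diagonal term carries \<psi>'', whose sign is not controlled; equal
          variances make its coefficient zero.\<close>
        using i by (simp add: inner var)
      also have "\<dots> \<ge> 0"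
      proof (rule sum_nonneg, rule mult_nonneg_nonneg)
        fix j assume "j \<in> I - {i}"
        thus "0 \<le> (\<Sum>k\<in>K. c' \<theta> i k * c \<theta> j k)"
          using i cov[of i j] sc by (simp add: inner)
      qed (intro mult_nonneg_nonneg mult_nonpos_nonpos decr prod0)
      finally show "0 \<le> (\<Sum>k\<in>K. c' \<theta> i k * F' \<theta> i k x)" .
    qed
    finally show ?thesis .
  qed

  \<comment> \<open>A dominating function independent of \<theta>, which makes Fubini
    applicable.\<close>
  define h where "h x = (\<Sum>i\<in>I. \<Sum>k\<in>K. (\<bar>a i k\<bar> + \<bar>b i k\<bar>) * (\<bar>x k\<bar> * B))" for x :: "'k \<Rightarrow> real"
  have h_int: "integrable \<mu> h"
    unfolding h_def \<mu>_def
    by (intro Bochner_Integration.integrable_sum integrable_mult_right integrable_mult_left integrable_abs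
        integrable_std_gauss_component fin)
  have h0: "0 \<le> h x" for x unfolding h_def using B by (intro sum_nonneg) auto
  have \<Phi>'h: "\<bar>\<Phi>' \<theta> x\<bar> \<le> h x" for \<theta> x
    unfolding \<Phi>'_def h_def
  proof (intro order.trans[OF sum_abs sum_mono])
    fix i k
    have "\<bar>c' \<theta> i k\<bar> \<le> \<bar>a i k\<bar> + \<bar>b i k\<bar>"
      unfolding c'_def
      by (rule order.trans[OF abs_triangle_ineq4 add_mono]) (auto simp: abs_mult intro!: mult_left_le_one_le)
    thus "\<bar>c' \<theta> i k * (x k * F \<theta> i x)\<bar> \<le> (\<bar>a i k\<bar> + \<bar>b i k\<bar>) * (\<bar>x k\<bar> * B)"
      unfolding abs_mult by (intro mult_mono Fb) auto
  qed
  \<comment> \<open>Instead of differentiating under the expectation, \<Phi>' is integrated over the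
    angle and the order is exchanged: one order integrates nonnegative numbers, the other gives the
    difference of the two expectations by the fundamental theorem.\<close>
  define f where "f \<theta> x = indicator {0..pi/2} \<theta> * \<Phi>' \<theta> x" for \<theta> :: real and x
  have fm: "case_prod f \<in> borel_measurable (lborel \<Otimes>\<^sub>M \<mu>)"
    unfolding f_def split_beta by measurable
  have f_int: "integrable (lborel \<Otimes>\<^sub>M \<mu>) (case_prod f)"
  proof (rule Bochner_Integration.integrable_bound)
    have [measurable]: "h \<in> borel_measurable \<mu>" using h_int by auto
    show "integrable (lborel \<Otimes>\<^sub>M \<mu>) (\<lambda>p. indicator {0..pi/2} (fst p) * h (snd p))"
      by (rule Fubini_integrable) (use h_int in \<open>auto simp: abs_mult\<close>)
    show "AE p in lborel \<Otimes>\<^sub>M \<mu>. norm (case_prod f p) \<le> norm (indicator {0..pi/2} (fst p) * h (snd p))"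
      using \<Phi>'h h0 by (auto simp: f_def abs_mult split: split_indicator)
  qed (rule fm)

  have dth: "((\<lambda>\<theta>. Z \<theta> i x) has_real_derivative (\<Sum>k\<in>K. c' \<theta> i k * x k)) (at \<theta>)" for i x \<theta>
    unfolding Z_def c_def c'_def by (auto intro!: derivative_eq_intros sum.cong simp: algebra_simps)
  have d\<Phi>: "((\<lambda>\<theta>. \<Phi> \<theta> x) has_real_derivative \<Phi>' \<theta> x) (at \<theta>)" for x \<theta>
    unfolding \<Phi>_def
    by (rule DERIV_cong[OF has_field_derivative_prod[OF DERIV_chain2[OF d1 dth]]])
       (simp add: \<Phi>'_def F_def sum_distrib_left sum_distrib_right algebra_simps)
  have cth: "continuous_on UNIV (\<lambda>\<theta>. Z \<theta> i x)" for i x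
    unfolding Z_def c_def by (intro continuous_intros)
  have c\<Phi>': "continuous_on UNIV (\<lambda>\<theta>. \<Phi>' \<theta> x)" for x
    unfolding \<Phi>'_def F_def c'_def
    by (intro continuous_intros continuous_on_compose2[OF cont0 cth] continuous_on_compose2[OF cont1 cth] subset_UNIV)
  have FTC: "(\<integral>\<theta>. f \<theta> x \<partial>lborel) = \<Phi> (pi/2) x - \<Phi> 0 x" for x
  proof -
    have "(\<integral>\<theta>. indicator {0..pi/2} \<theta> *\<^sub>R \<Phi>' \<theta> x \<partial>lborel) = \<Phi> (pi/2) x - \<Phi> 0 x"
      by (rule integral_FTC_Icc)
        (use d\<Phi> c\<Phi>' in \<open>auto simp: has_real_derivative_iff_has_vector_derivative[symmetric]
          intro: continuous_on_subset has_field_derivative_at_within\<close>)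
    thus ?thesis by (simp add: f_def)
  qed
  have \<Phi>int: "integrable \<mu> (\<Phi> \<theta>)" for \<theta>
    by (rule Mu.integrable_const_bound[where B = 1]) (use prod1 in \<open>auto simp: \<Phi>_def\<close>)
  have "0 \<le> (\<integral>\<theta>. (\<integral>x. f \<theta> x \<partial>\<mu>) \<partial>lborel)"
    by (rule Bochner_Integration.integral_nonneg) (use nonneg in \<open>auto simp: f_def split: split_indicator\<close>)
  also have "\<dots> = (\<integral>x. (\<integral>\<theta>. f \<theta> x \<partial>lborel) \<partial>\<mu>)"
    using Fubini_integral[OF f_int] by simp
  also have "\<dots> = (\<integral>x. \<Phi> (pi/2) x \<partial>\<mu>) - (\<integral>x. \<Phi> 0 x \<partial>\<mu>)"
    unfolding FTC using \<Phi>int by simp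
  finally show ?thesis by (simp add: \<Phi>_def Z_def c_def \<mu>_def)
qed

section \<open>Exponential moments of the standard normal law\<close>

lemma nn_integral_normal_density: "0 < \<sigma> \<Longrightarrow> (\<integral>\<^sup>+y. ennreal (normal_density \<mu> \<sigma> y) \<partial>lborel) = 1"
  by (subst nn_integral_eq_integral) auto

text \<open>Completing the square: tilting the standard density by exp (l y) gives exp (l^2 / 2)
  times the normal density of mean \<open>l\<close> and variance 1.\<close>

lemma nn_integral_std_gauss_exp:
  "(\<integral>\<^sup>+y. ennreal (exp (l * y)) \<partial>std_gauss) = ennreal (exp (l\<^sup>2 / 2))"
proof -
  have "(\<integral>\<^sup>+y. ennreal (exp (l * y)) \<partial>std_gauss)
      = (\<integral>\<^sup>+y. ennreal (exp (l\<^sup>2 / 2)) * ennreal (normal_density l 1 y) \<partial>lborel)"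
    unfolding std_gauss_def
    by (subst nn_integral_density)
       (auto simp: normal_density_def ennreal_mult[symmetric] mult_exp_exp power2_eq_square
         field_simps intro!: nn_integral_cong)
  also have "\<dots> = ennreal (exp (l\<^sup>2 / 2))"
    by (subst nn_integral_cmult) (auto simp: nn_integral_normal_density)
  finally show ?thesis .
qed

text \<open>The weight turns the standard density into \<open>s\<close> times the centred normal
  density of standard deviation \<open>s = 1 / sqrt (1 - 2 * c)\<close>. This is the moment
  generating function of a chi-square variable with one degree of freedom.\<close>

lemma nn_integral_std_gauss_exp_square:
  assumes "c < 1 / 2"
  shows "(\<integral>\<^sup>+y. ennreal (exp (c * y\<^sup>2)) \<partial>std_gauss) = ennreal (1 / sqrt (1 - 2 * c))"
proof -
  define s where "s = 1 / sqrt (1 - 2 * c)"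
  have s: "0 < s" "s\<^sup>2 = 1 / (1 - 2 * c)" using assms by (auto simp: s_def power_divide)
  have eq: "std_normal_density y * exp (c * y\<^sup>2) = s * normal_density 0 s y" for y
  proof -
    have "- y\<^sup>2 / 2 + c * y\<^sup>2 = - y\<^sup>2 / (2 * s\<^sup>2)"
      using assms by (simp add: s(2) field_simps)
    moreover have "sqrt (2 * pi * s\<^sup>2) = s * sqrt (2 * pi)"
      using s(1) by (simp add: real_sqrt_mult)
    ultimately show ?thesis
      using s(1) by (simp add: normal_density_def mult_exp_exp)
  qed
  have "(\<integral>\<^sup>+y. ennreal (exp (c * y\<^sup>2)) \<partial>std_gauss)
      = (\<integral>\<^sup>+y. ennreal s * ennreal (normal_density 0 s y) \<partial>lborel)"
    unfolding std_gauss_def using s(1)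
    by (subst nn_integral_density) (auto simp: ennreal_mult[symmetric] eq intro!: nn_integral_cong)
  also have "\<dots> = ennreal s"
    using s(1) by (subst nn_integral_cmult) (auto simp: nn_integral_normal_density)
  finally show ?thesis by (simp add: s_def)
qed

section \<open>Comparison of tails and of integrals\<close>

text \<open>The smooth inequality is applied to logistic functions that steepen to a step at
  \<open>s\<close>. Their limit is 1/2 at the threshold itself, which is why the left event is
  strict and the right one is not.\<close>

lemma slepian_tail:
  fixes a b :: "'i \<Rightarrow> 'k \<Rightarrow> real"
  assumes fin: "finite I" "finite K"
    and orth: "\<And>i j. i \<in> I \<Longrightarrow> j \<in> I \<Longrightarrow> (\<Sum>k\<in>K. a i k * b j k) = 0"
    and var: "\<And>i. i \<in> I \<Longrightarrow> (\<Sum>k\<in>K. a i k * a i k) = (\<Sum>k\<in>K. b i k * b i k)"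
    and cov: "\<And>i j. i \<in> I \<Longrightarrow> j \<in> I \<Longrightarrow> (\<Sum>k\<in>K. b i k * b j k) \<le> (\<Sum>k\<in>K. a i k * a j k)"
  defines "\<mu> \<equiv> Pi\<^sub>M K (\<lambda>_. std_gauss)"
  shows "measure \<mu> {x \<in> space \<mu>. \<exists>i\<in>I. (\<Sum>k\<in>K. a i k * x k) > s}
       \<le> measure \<mu> {x \<in> space \<mu>. \<exists>i\<in>I. (\<Sum>k\<in>K. b i k * x k) \<ge> s}"
proof -
  interpret product_prob_space "\<lambda>_::'k. std_gauss" K by (rule product_prob_space_std_gauss)
  interpret Mu: prob_space \<mu> unfolding \<mu>_def by (rule P.prob_space_axioms)
  have [measurable]: "(\<lambda>x. x k) \<in> borel_measurable \<mu>" if "k \<in> K" for k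
    unfolding \<mu>_def using that integrable_std_gauss_component[OF fin(2)] by auto
  define \<psi> where "\<psi> n t = 1 / (1 + exp (real n * (t - s)))" for n t
  define L where "L t = (if t < s then 1 else if t = s then 1/2 else 0 :: real)" for t
  have range: "0 \<le> \<psi> n t" "\<psi> n t \<le> 1" for n t
    by (auto simp: \<psi>_def divide_le_eq add_pos_pos)
  have [measurable]: "\<psi> n \<in> borel_measurable borel" "L \<in> borel_measurable borel" for n
    unfolding \<psi>_def L_def by measurable
  have lim: "(\<lambda>n. \<psi> n t) \<longlonglongrightarrow> L t" for t
  proof -
    consider "t < s" | "t = s" | "t > s" by linarith
    thus ?thesis
    proof cases
      case 1
      hence "(\<lambda>n. 1 / (1 + exp (real n * (t - s)))) \<longlonglongrightarrow> 1" by real_asymp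
      with 1 show ?thesis by (simp add: \<psi>_def L_def)
    next
      case 3
      hence "(\<lambda>n. 1 / (1 + exp (real n * (t - s)))) \<longlonglongrightarrow> 0" by real_asymp
      with 3 show ?thesis by (simp add: \<psi>_def L_def)
    qed (simp add: \<psi>_def L_def)
  qed
  have prod1: "\<bar>\<Prod>j\<in>I. \<psi> n (f j)\<bar> \<le> 1" for f n
    unfolding abs_prod by (rule prod_le_1) (use range in auto)
  define Za Zb where "Za i x = (\<Sum>k\<in>K. a i k * x k)" and "Zb i x = (\<Sum>k\<in>K. b i k * x k)"
    for i and x :: "'k \<Rightarrow> real"
  have [measurable]: "Za i \<in> borel_measurable \<mu>" "Zb i \<in> borel_measurable \<mu>" for i
    unfolding Za_def Zb_def by measurable
  have le: "(\<integral>x. (\<Prod>i\<in>I. \<psi> n (Zb i x)) \<partial>\<mu>) \<le> (\<integral>x. (\<Prod>i\<in>I. \<psi> n (Za i x)) \<partial>\<mu>)" for n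
    unfolding \<mu>_def Za_def Zb_def
  \<comment> \<open>The logistic function solves \<psi>' = - n \<psi> (1 - \<psi>), so both
    derivatives are polynomials in \<psi>; as \<psi> lies in [0, 1], they are bounded by n and
    n^2.\<close>
  proof (rule slepian_smooth[OF fin orth var cov, where \<psi>' = "\<lambda>t. - real n * (\<psi> n t * (1 - \<psi> n t))"
        and \<psi>'' = "\<lambda>t. (real n)\<^sup>2 * (\<psi> n t * (1 - \<psi> n t)) * (1 - 2 * \<psi> n t)" and B = "real n + (real n)\<^sup>2"])
    have pos: "1 + exp (real n * (t - s)) > 0" for t by (simp add: add_pos_pos)
    show d: "(\<psi> n has_real_derivative - real n * (\<psi> n t * (1 - \<psi> n t))) (at t)" for t
      unfolding \<psi>_def
      by (rule derivative_eq_intros refl pos[of t, THEN less_imp_neq, symmetric])+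
         (use pos[of t] in \<open>simp add: field_simps power2_eq_square\<close>)
    show "((\<lambda>t. - real n * (\<psi> n t * (1 - \<psi> n t))) has_real_derivative
        (real n)\<^sup>2 * (\<psi> n t * (1 - \<psi> n t)) * (1 - 2 * \<psi> n t)) (at t)" for t
      by (rule derivative_eq_intros d refl)+ (simp add: algebra_simps power2_eq_square)
    have "continuous_on UNIV (\<psi> n)"
      using d by (meson DERIV_isCont continuous_at_imp_continuous_on)
    thus "continuous_on UNIV (\<lambda>t. (real n)\<^sup>2 * (\<psi> n t * (1 - \<psi> n t)) * (1 - 2 * \<psi> n t))"
      by (intro continuous_intros)
    have u: "0 \<le> \<psi> n t * (1 - \<psi> n t)" "\<psi> n t * (1 - \<psi> n t) \<le> 1" for t
      using range[of n t] by (auto intro!: mult_le_one)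
    show "- real n * (\<psi> n t * (1 - \<psi> n t)) \<le> 0" for t
      using u(1)[of t] by simp
    show "\<bar>- real n * (\<psi> n t * (1 - \<psi> n t))\<bar> \<le> real n + (real n)\<^sup>2" for t
    proof -
      have "real n * (\<psi> n t * (1 - \<psi> n t)) \<le> real n * 1"
        by (intro mult_left_mono u) auto
      moreover have "0 \<le> real n * (\<psi> n t * (1 - \<psi> n t))" using u(1)[of t] by simp
      ultimately show ?thesis by (simp add: abs_mult_pos' add_increasing2)
    qed
    show "\<bar>(real n)\<^sup>2 * (\<psi> n t * (1 - \<psi> n t)) * (1 - 2 * \<psi> n t)\<bar> \<le> real n + (real n)\<^sup>2" for t
    proof -
      have "(real n)\<^sup>2 * \<bar>\<psi> n t * (1 - \<psi> n t)\<bar> * \<bar>1 - 2 * \<psi> n t\<bar> \<le> (real n)\<^sup>2 * 1 * 1"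
        by (intro mult_mono) (use u[of t] range[of n t] in auto)
      thus ?thesis by (simp add: abs_mult)
    qed
  qed (assumption | rule range)+
  have conv: "(\<lambda>n. \<integral>x. (\<Prod>i\<in>I. \<psi> n (Z i x)) \<partial>\<mu>) \<longlonglongrightarrow> (\<integral>x. (\<Prod>i\<in>I. L (Z i x)) \<partial>\<mu>)"
    if [measurable]: "\<And>i. Z i \<in> borel_measurable \<mu>" for Z
    by (rule integral_dominated_convergence[where w="\<lambda>_. 1"])
       (use lim prod1 in \<open>auto intro!: tendsto_prod\<close>)
  have leL: "(\<integral>x. (\<Prod>i\<in>I. L (Zb i x)) \<partial>\<mu>) \<le> (\<integral>x. (\<Prod>i\<in>I. L (Za i x)) \<partial>\<mu>)"
    by (rule LIMSEQ_le[OF conv conv]) (use le in auto)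
  have prodL: "0 \<le> (\<Prod>i\<in>I. L (f i))" "(\<Prod>i\<in>I. L (f i)) \<le> 1" for f :: "'i \<Rightarrow> real"
    by (auto intro!: prod_nonneg prod_le_1 simp: L_def)
  have intL: "integrable \<mu> (\<lambda>x. \<Prod>i\<in>I. L (Z i x))" if [measurable]: "\<And>i. Z i \<in> borel_measurable \<mu>" for Z
    by (rule Mu.integrable_const_bound[where B = 1]) (use prodL in auto)
  \<comment> \<open>The product of the limits lies between the indicator of \<open>?B\<close>, where
    every factor is 1, and that of \<open>?A\<close>, outside which some factor is 0. Complements
    then give the exceedance events.\<close>
  let ?A = "{x \<in> space \<mu>. \<forall>i\<in>I. Za i x \<le> s}" and ?B = "{x \<in> space \<mu>. \<forall>i\<in>I. Zb i x < s}"
  have [measurable]: "?A \<in> sets \<mu>" "?B \<in> sets \<mu>" using fin(1) by measurable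
  have int_ind: "integrable \<mu> (indicator E :: _ \<Rightarrow> real)" if "E \<in> sets \<mu>" for E
    using that by (simp add: integrable_indicator_iff Mu.emeasure_eq_measure)
  have "measure \<mu> ?B = (\<integral>x. indicator ?B x \<partial>\<mu>)" by simp
  also have "\<dots> \<le> (\<integral>x. (\<Prod>i\<in>I. L (Zb i x)) \<partial>\<mu>)"
    by (rule integral_mono[OF int_ind intL]) (use prodL in \<open>auto simp: L_def split: split_indicator\<close>)
  also note leL
  also have "(\<integral>x. (\<Prod>i\<in>I. L (Za i x)) \<partial>\<mu>) \<le> (\<integral>x. indicator ?A x \<partial>\<mu>)"
  proof (rule integral_mono[OF intL int_ind])
    fix x assume x: "x \<in> space \<mu>"
    show "(\<Prod>i\<in>I. L (Za i x)) \<le> indicator ?A x"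
    proof (cases "x \<in> ?A")
      case False
      then obtain i where "i \<in> I" "L (Za i x) = 0" using x by (auto simp: L_def)
      hence "(\<Prod>i\<in>I. L (Za i x)) = 0" using fin(1) by (intro prod_zero) auto
      thus ?thesis by simp
    qed (use prodL in auto)
  qed measurable
  also have "\<dots> = measure \<mu> ?A" by simp
  finally have *: "measure \<mu> ?B \<le> measure \<mu> ?A" .
  have "measure \<mu> (space \<mu> - ?A) \<le> measure \<mu> (space \<mu> - ?B)"
    using * by (subst (1 2) Mu.prob_compl) auto
  also have "space \<mu> - ?A = {x \<in> space \<mu>. \<exists>i\<in>I. (\<Sum>k\<in>K. a i k * x k) > s}"
    by (auto simp: Za_def not_le)
  also have "space \<mu> - ?B = {x \<in> space \<mu>. \<exists>i\<in>I. (\<Sum>k\<in>K. b i k * x k) \<ge> s}"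
    by (auto simp: Zb_def not_less)
  finally show ?thesis .
qed

text \<open>Layer-cake formula: by Tonelli each integral is the integral of its tail measures over r
  > 0. Strict and weak tails mix freely because open and half-open intervals have the same
  length.\<close>

lemma nn_integral_mono_tail:
  fixes F G :: "'a \<Rightarrow> real"
  assumes "sigma_finite_measure M"
    and [measurable]: "F \<in> borel_measurable M" "G \<in> borel_measurable M"
    and nonneg: "\<And>x. 0 \<le> F x" "\<And>x. 0 \<le> G x"
    and tail: "\<And>r. 0 < r \<Longrightarrow> emeasure M {x \<in> space M. r < F x} \<le> emeasure M {x \<in> space M. r \<le> G x}"
  shows "(\<integral>\<^sup>+x. ennreal (F x) \<partial>M) \<le> (\<integral>\<^sup>+x. ennreal (G x) \<partial>M)"
proof -
  interpret sigma_finite_measure M by fact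
  interpret pair_sigma_finite lborel M ..
  have "(\<integral>\<^sup>+x. ennreal (F x) \<partial>M) = (\<integral>\<^sup>+x. (\<integral>\<^sup>+r. indicator {r::real. 0 < r \<and> r < F x} r \<partial>lborel) \<partial>M)"
  proof (rule nn_integral_cong)
    fix x
    have "{r. 0 < r \<and> r < F x} = {0<..<F x}" by auto
    thus "ennreal (F x) = (\<integral>\<^sup>+r. indicator {r. 0 < r \<and> r < F x} r \<partial>lborel)"
      using nonneg by simp
  qed
  also have "\<dots> = (\<integral>\<^sup>+r. (\<integral>\<^sup>+x. indicator {r::real. 0 < r \<and> r < F x} r \<partial>M) \<partial>lborel)"
    by (rule Fubini') measurable
  also have "\<dots> \<le> (\<integral>\<^sup>+r. (\<integral>\<^sup>+x. indicator {r::real. 0 < r \<and> r \<le> G x} r \<partial>M) \<partial>lborel)"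
  proof (rule nn_integral_mono)
    fix r :: real
    have 1: "(\<integral>\<^sup>+x. indicator {r. 0 < r \<and> r < F x} r \<partial>M)
        = (if 0 < r then emeasure M {x \<in> space M. r < F x} else 0)"
    proof (cases "0 < r")
      case True
      have "(\<integral>\<^sup>+x. indicator {r. 0 < r \<and> r < F x} r \<partial>M) = (\<integral>\<^sup>+x. indicator {x \<in> space M. r < F x} x \<partial>M)"
        using True by (intro nn_integral_cong) (auto split: split_indicator)
      thus ?thesis using True by (simp add: nn_integral_indicator)
    qed simp
    have 2: "(\<integral>\<^sup>+x. indicator {r. 0 < r \<and> r \<le> G x} r \<partial>M)
        = (if 0 < r then emeasure M {x \<in> space M. r \<le> G x} else 0)"
    proof (cases "0 < r")
      case True
      have "(\<integral>\<^sup>+x. indicator {r. 0 < r \<and> r \<le> G x} r \<partial>M) = (\<integral>\<^sup>+x. indicator {x \<in> space M. r \<le> G x} x \<partial>M)"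
        using True by (intro nn_integral_cong) (auto split: split_indicator)
      thus ?thesis using True by (simp add: nn_integral_indicator)
    qed simp
    show "(\<integral>\<^sup>+x. indicator {r::real. 0 < r \<and> r < F x} r \<partial>M)
        \<le> (\<integral>\<^sup>+x. indicator {r::real. 0 < r \<and> r \<le> G x} r \<partial>M)"
      unfolding 1 2 using tail by simp
  qed
  also have "\<dots> = (\<integral>\<^sup>+x. (\<integral>\<^sup>+r. indicator {r::real. 0 < r \<and> r \<le> G x} r \<partial>lborel) \<partial>M)"
    by (rule Fubini'[symmetric]) measurable
  also have "\<dots> = (\<integral>\<^sup>+x. ennreal (G x) \<partial>M)"
  proof (rule nn_integral_cong)
    fix x
    have "{r. 0 < r \<and> r \<le> G x} = {0<..G x}" by auto
    thus "(\<integral>\<^sup>+r. indicator {r. 0 < r \<and> r \<le> G x} r \<partial>lborel) = ennreal (G x)"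
      using nonneg by simp
  qed
  finally show ?thesis .
qed

section \<open>Norms of Gaussian matrices\<close>

text \<open>The coefficients \<open>Q i\<close> live on the possibly many samples, but only their
  inner products enter the covariances. These agree with those of unit vectors in dimension
  \<open>CARD('k)\<close>, so the bound involves that dimension and not the number of
  samples.\<close>

lemma gaussian_bilinear_tail:
  fixes p :: "'i \<Rightarrow> real^'k" and v :: "'i \<Rightarrow> real^'m" and Q :: "'i \<Rightarrow> 'l \<Rightarrow> real"
  assumes fin: "finite I" "finite L"
    and unit: "\<And>i. i \<in> I \<Longrightarrow> norm (p i) = 1" "\<And>i. i \<in> I \<Longrightarrow> norm (v i) = 1"
    and gram: "\<And>i j. i \<in> I \<Longrightarrow> j \<in> I \<Longrightarrow> (\<Sum>l\<in>L. Q i l * Q j l) = p i \<bullet> p j"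
    and t: "0 \<le> t"
  defines "\<mu> \<equiv> Pi\<^sub>M (L \<times> UNIV) (\<lambda>_. std_gauss)"
  shows "measure \<mu> {x \<in> space \<mu>. \<exists>i\<in>I. (\<Sum>l\<in>L. \<Sum>m\<in>UNIV. Q i l * v i $ m * x (l, m))
            > sqrt (real CARD('k)) + sqrt (real CARD('m)) + t} \<le> exp (- t\<^sup>2 / 2)"
\<comment> \<open>For t = 0 the bound is 1, and for empty \<open>I\<close> the event is empty. The
  remaining case may divide by \<open>t\<close> and take maxima over \<open>I\<close>.\<close>
proof (cases "t = 0 \<or> I = {}")
  case True
  have "prob_space \<mu>"
    unfolding \<mu>_def by (intro prob_space_PiM prob_space_std_gauss)
  thus ?thesis using True by (auto intro: prob_space.prob_le_1)
next
  case False
  with t have t: "0 < t" and I: "I \<noteq> {}" by auto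
  \<comment> \<open>Coordinates: the entries of the Gaussian matrix, one scalar that equalises the variances, and the
    two Gaussian vectors of the comparison process.\<close>
  define K' :: "(('l \<times> 'm) + unit + ('k + 'm)) set"
    where "K' = (L \<times> UNIV) <+> ({} <+> (UNIV <+> UNIV))"
  define g0 :: "('l \<times> 'm) + unit + ('k + 'm)" where "g0 = Inr (Inl ())"
  \<comment> \<open>Written as an insertion so that the variance-equalising scalar can be integrated
    out on its own.\<close>
  define K where "K = insert g0 K'"
  have K_Plus: "K = (L \<times> UNIV) <+> ({()} <+> (UNIV <+> UNIV))"
    by (auto simp: K_def K'_def g0_def)
  have finK: "finite K'" "finite K" "g0 \<notin> K'" using fin by (auto simp: K_def K'_def g0_def)
  interpret S: product_prob_space "\<lambda>_::('l \<times> 'm) + unit + ('k + 'm). std_gauss" K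
    by (rule product_prob_space_std_gauss)
  interpret S': product_prob_space "\<lambda>_::('l \<times> 'm) + unit + ('k + 'm). std_gauss" K'
    by (rule product_prob_space_std_gauss)
  have sumK: "(\<Sum>k\<in>K. f k) = (\<Sum>l\<in>L. \<Sum>m\<in>UNIV. f (Inl (l, m))) + f g0
      + (\<Sum>j\<in>UNIV. f (Inr (Inr (Inl j)))) + (\<Sum>m\<in>UNIV. f (Inr (Inr (Inr m))))"
    for f :: "_ \<Rightarrow> real"
    using fin by (simp add: K_Plus g0_def sum.Plus sum.cartesian_product split_def del: UNIV_Plus_UNIV)
  define a b :: "'i \<Rightarrow> ('l \<times> 'm) + unit + ('k + 'm) \<Rightarrow> real" where
    "a i k = (case k of Inl lm \<Rightarrow> Q i (fst lm) * v i $ (snd lm) | Inr (Inl _) \<Rightarrow> 1 | Inr (Inr _) \<Rightarrow> 0)" and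
    "b i k = (case k of Inl _ \<Rightarrow> 0 | Inr (Inl _) \<Rightarrow> 0 | Inr (Inr (Inl j)) \<Rightarrow> p i $ j
              | Inr (Inr (Inr m)) \<Rightarrow> v i $ m)" for i k
  have aa: "(\<Sum>k\<in>K. a i k * a j k) = (p i \<bullet> p j) * (v i \<bullet> v j) + 1" if "i \<in> I" "j \<in> I" for i j
  proof -
    have "(\<Sum>k\<in>K. a i k * a j k) = (\<Sum>l\<in>L. Q i l * Q j l) * (\<Sum>m\<in>UNIV. v i $ m * v j $ m) + 1"
      unfolding sumK by (simp add: a_def g0_def sum_product mult_ac)
    thus ?thesis using gram[OF that] by (simp add: inner_vec_def)
  qed
  have bb: "(\<Sum>k\<in>K. b i k * b j k) = p i \<bullet> p j + v i \<bullet> v j" for i j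
    unfolding sumK by (simp add: b_def g0_def inner_vec_def)
  have ab: "(\<Sum>k\<in>K. a i k * b j k) = 0" for i j
    unfolding sumK by (simp add: a_def b_def g0_def)
  have unit_inner: "p i \<bullet> p i = 1" "v i \<bullet> v i = 1" if "i \<in> I" for i
    using unit[OF that] by (simp_all add: norm_eq_1)
  have var: "(\<Sum>k\<in>K. a i k * a i k) = (\<Sum>k\<in>K. b i k * b i k)" if "i \<in> I" for i
    using that by (simp add: aa bb unit_inner)
  have cov: "(\<Sum>k\<in>K. b i k * b j k) \<le> (\<Sum>k\<in>K. a i k * a j k)" if "i \<in> I" "j \<in> I" for i j
  proof -
    have "p i \<bullet> p j \<le> 1" "v i \<bullet> v j \<le> 1"
      using norm_cauchy_schwarz[of "p i" "p j"] norm_cauchy_schwarz[of "v i" "v j"] unit that by auto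
    hence "0 \<le> (1 - p i \<bullet> p j) * (1 - v i \<bullet> v j)" by (intro mult_nonneg_nonneg) auto
    thus ?thesis using that by (simp add: aa bb algebra_simps)
  qed

  define X where "X i x = (\<Sum>l\<in>L. \<Sum>m\<in>UNIV. Q i l * v i $ m * x (Inl (l, m)))"
    for i and x :: "('l \<times> 'm) + unit + ('k + 'm) \<Rightarrow> real"
  have Za: "(\<Sum>k\<in>K. a i k * x k) = X i x + x g0" for i x
    unfolding sumK X_def by (simp add: a_def g0_def)
  define g :: "_ \<Rightarrow> real^'k" where "g x = (\<chi> j. x (Inr (Inr (Inl j))))"
    for x :: "('l \<times> 'm) + unit + ('k + 'm) \<Rightarrow> real"
  define h :: "_ \<Rightarrow> real^'m" where "h x = (\<chi> m. x (Inr (Inr (Inr m))))"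
    for x :: "('l \<times> 'm) + unit + ('k + 'm) \<Rightarrow> real"
  have Zb: "(\<Sum>k\<in>K. b i k * x k) = p i \<bullet> g x + v i \<bullet> h x" for i x
    unfolding sumK by (simp add: b_def g0_def g_def h_def inner_vec_def)
  have Zb_le: "(\<Sum>k\<in>K. b i k * x k) \<le> norm (g x) + norm (h x)" if "i \<in> I" for i x
    unfolding Zb using norm_cauchy_schwarz[of "p i" "g x"] norm_cauchy_schwarz[of "v i" "h x"] unit that
    by auto

  \<comment> \<open>\<open>MX\<close> leaves out \<open>g0\<close>, so the exponential of the
    maximum of the first process is \<open>MX x * exp (t * x g0)\<close>. \<open>G\<close> dominates
    that of the second process by Cauchy-Schwarz.\<close>
  define MX where "MX x = Max ((\<lambda>i. exp (t * X i x)) ` I)" for x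
  define G where "G x = exp (t * (norm (g x) + norm (h x)))" for x
  have comp: "(\<lambda>x. x k) \<in> borel_measurable (Pi\<^sub>M K (\<lambda>_. std_gauss))" if "k \<in> K" for k
    using that integrable_std_gauss_component[OF finK(2)] by auto
  have comp': "(\<lambda>x. x k) \<in> borel_measurable (Pi\<^sub>M K' (\<lambda>_. std_gauss))" if "k \<in> K'" for k
    using that integrable_std_gauss_component[OF finK(1)] by auto
  have memK: "Inr (Inr z) \<in> K" "g0 \<in> K" for z by (auto simp: K_def K'_def)
  have memK': "l \<in> L \<Longrightarrow> Inl (l, m) \<in> K'" "l \<in> L \<Longrightarrow> Inl (l, m) \<in> K" for l m
    by (auto simp: K_def K'_def)
  have Xm: "X i \<in> borel_measurable (Pi\<^sub>M K (\<lambda>_. std_gauss))" "X i \<in> borel_measurable (Pi\<^sub>M K' (\<lambda>_. std_gauss))" for i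
    unfolding X_def by (auto intro!: borel_measurable_sum borel_measurable_times comp comp' memK')
  have [measurable]: "MX \<in> borel_measurable (Pi\<^sub>M K (\<lambda>_. std_gauss))" "MX \<in> borel_measurable (Pi\<^sub>M K' (\<lambda>_. std_gauss))"
    unfolding MX_def by (auto intro!: borel_measurable_Max measurable_compose[OF _ borel_measurable_exp]
      borel_measurable_times Xm fin)
  have [measurable]: "G \<in> borel_measurable (Pi\<^sub>M K (\<lambda>_. std_gauss))"
    unfolding G_def norm_vec_def L2_set_def g_def h_def using comp[OF memK(1)] by simp
  have MX_ge: "exp (t * X i x) \<le> MX x" if "i \<in> I" for i x
    unfolding MX_def using that fin by (intro Max_ge) auto
  have MX_obtain: "\<exists>i\<in>I. MX x = exp (t * X i x)" for x
  proof -
    have "MX x \<in> (\<lambda>i. exp (t * X i x)) ` I"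
      unfolding MX_def using I fin by (intro Max_in) auto
    thus ?thesis by blast
  qed
  have G0: "0 \<le> G x" for x by (simp add: G_def)
  have MX0: "0 \<le> MX x" for x using MX_obtain[of x] by auto

  have "(\<integral>\<^sup>+x. ennreal (MX x * exp (t * x g0)) \<partial>Pi\<^sub>M K (\<lambda>_. std_gauss)) \<le> (\<integral>\<^sup>+x. ennreal (G x) \<partial>Pi\<^sub>M K (\<lambda>_. std_gauss))"
  proof (rule nn_integral_mono_tail)
    show "sigma_finite_measure (Pi\<^sub>M K (\<lambda>_. std_gauss))" ..
    show "(\<lambda>x. MX x * exp (t * x g0)) \<in> borel_measurable (Pi\<^sub>M K (\<lambda>_. std_gauss))"
      using comp[OF memK(2)] by simp
    fix r :: real assume r: "0 < r"
    \<comment> \<open>The level \<open>r\<close> of an exponential is the level \<open>s\<close> of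
      the linear process in its exponent.\<close>
    define s where "s = ln r / t"
    let ?P = "Pi\<^sub>M K (\<lambda>_. std_gauss)"
    have "measure ?P {x \<in> space ?P. r < MX x * exp (t * x g0)}
       \<le> measure ?P {x \<in> space ?P. \<exists>i\<in>I. (\<Sum>k\<in>K. a i k * x k) > s}"
    proof (intro S.P.finite_measure_mono subsetI)
      fix x assume x: "x \<in> {x \<in> space ?P. r < MX x * exp (t * x g0)}"
      obtain i where i: "i \<in> I" "MX x = exp (t * X i x)" using MX_obtain by blast
      have "ln r < t * (X i x + x g0)"
        using x i r by (simp add: mult_exp_exp distrib_left) (metis exp_less_cancel_iff exp_ln)
      thus "x \<in> {x \<in> space ?P. \<exists>i\<in>I. (\<Sum>k\<in>K. a i k * x k) > s}"
        using x i(1) t unfolding Za s_def by (auto simp: pos_divide_less_eq mult.commute intro!: bexI[of _ i])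
    next
      show "{x \<in> space ?P. \<exists>i\<in>I. (\<Sum>k\<in>K. a i k * x k) > s} \<in> sets ?P"
        unfolding Za using Xm comp[OF memK(2)] fin by measurable
    qed
    also have "\<dots> \<le> measure ?P {x \<in> space ?P. \<exists>i\<in>I. (\<Sum>k\<in>K. b i k * x k) \<ge> s}"
      by (rule slepian_tail[OF fin(1) finK(2) ab var cov])
    also have "\<dots> \<le> measure ?P {x \<in> space ?P. r \<le> G x}"
    proof (intro S.P.finite_measure_mono subsetI)
      fix x assume x: "x \<in> {x \<in> space ?P. \<exists>i\<in>I. (\<Sum>k\<in>K. b i k * x k) \<ge> s}"
      hence "s \<le> norm (g x) + norm (h x)" using Zb_le[of _ x] by (auto intro: order.trans)
      hence "ln r \<le> t * (norm (g x) + norm (h x))" using t by (simp add: s_def field_simps)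
      hence "r \<le> G x" unfolding G_def using r by (metis exp_le_cancel_iff exp_ln)
      thus "x \<in> {x \<in> space ?P. r \<le> G x}" using x by auto
    qed measurable
    finally show "emeasure ?P {x \<in> space ?P. r < MX x * exp (t * x g0)} \<le> emeasure ?P {x \<in> space ?P. r \<le> G x}"
      by (simp add: S.P.emeasure_eq_measure)
  qed (use MX0 G0 in auto)
  also have "(\<integral>\<^sup>+x. ennreal (MX x * exp (t * x g0)) \<partial>Pi\<^sub>M K (\<lambda>_. std_gauss))
      = (\<integral>\<^sup>+x. ennreal (MX x) \<partial>Pi\<^sub>M K' (\<lambda>_. std_gauss)) * ennreal (exp (t\<^sup>2 / 2))"
  proof -
    \<comment> \<open>\<open>MX\<close> does not read \<open>g0\<close>, so the inner integral over
      that coordinate is the moment exp (t^2 / 2).\<close>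
    have upd: "MX (x(g0 := y)) = MX x" for x y
      by (simp add: MX_def X_def g0_def)
    have "(\<integral>\<^sup>+x. ennreal (MX x * exp (t * x g0)) \<partial>Pi\<^sub>M K (\<lambda>_. std_gauss))
      = (\<integral>\<^sup>+x. (\<integral>\<^sup>+y. ennreal (MX x) * ennreal (exp (t * y)) \<partial>std_gauss) \<partial>Pi\<^sub>M K' (\<lambda>_. std_gauss))"
      unfolding K_def using comp[OF memK(2)] MX0
      by (subst S.product_nn_integral_insert[OF finK(1,3)])
         (simp_all add: upd K_def[symmetric] ennreal_mult)
    also have "\<dots> = (\<integral>\<^sup>+x. ennreal (MX x) * ennreal (exp (t\<^sup>2 / 2)) \<partial>Pi\<^sub>M K' (\<lambda>_. std_gauss))"
      by (simp add: nn_integral_cmult nn_integral_std_gauss_exp)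
    finally show ?thesis by (simp add: nn_integral_multc)
  qed
  finally have main: "(\<integral>\<^sup>+x. ennreal (MX x) \<partial>Pi\<^sub>M K' (\<lambda>_. std_gauss)) * ennreal (exp (t\<^sup>2 / 2))
      \<le> (\<integral>\<^sup>+x. ennreal (G x) \<partial>Pi\<^sub>M K (\<lambda>_. std_gauss))" .

  \<comment> \<open>\<open>\<alpha>\<close> and \<open>\<beta>\<close> are weights for \<open>\<parallel>g\<parallel> \<le> \<parallel>g\<parallel>\<^sup>2 / (2\<alpha>) + \<alpha> / 2\<close>: they make the resulting bound on the
    moment generating function of \<open>\<parallel>g\<parallel>\<close> exactly \<open>exp (t \<surd>k + t\<^sup>2 / 2)\<close>.\<close>
  define \<alpha> \<beta> where "\<alpha> = sqrt (real CARD('k)) + t" and "\<beta> = sqrt (real CARD('m)) + t"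
  have \<alpha>\<beta>: "0 < \<alpha>" "0 < \<beta>" using t by (auto simp: \<alpha>_def \<beta>_def add_nonneg_pos)
  \<comment> \<open>Coefficients of the squared coordinates after the quadratic bound on the norms;
    coordinates outside the two Gaussian vectors get 0 and contribute a factor 1.\<close>
  define c :: "('l \<times> 'm) + unit + ('k + 'm) \<Rightarrow> real" where
    "c k = (case k of Inl _ \<Rightarrow> 0 | Inr (Inl _) \<Rightarrow> 0 | Inr (Inr (Inl _)) \<Rightarrow> t / (2 * \<alpha>)
              | Inr (Inr (Inr _)) \<Rightarrow> t / (2 * \<beta>))" for k
  have amgm: "n \<le> n\<^sup>2 / (2 * e) + e / 2" if "0 < e" for n e :: real
    using that zero_le_power2[of "n - e"] by (simp add: field_simps power2_eq_square)
  have G_le: "G x \<le> exp (t * (\<alpha> + \<beta>) / 2) * (\<Prod>k\<in>K. exp (c k * (x k)\<^sup>2))" for x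
  proof -
    have norms: "(norm (g x))\<^sup>2 = (\<Sum>j\<in>UNIV. (x (Inr (Inr (Inl j))))\<^sup>2)"
        "(norm (h x))\<^sup>2 = (\<Sum>m\<in>UNIV. (x (Inr (Inr (Inr m))))\<^sup>2)"
      by (simp_all add: g_def h_def norm_vec_def L2_set_def sum_nonneg)
    have "(\<Sum>k\<in>K. c k * (x k)\<^sup>2) = t / (2 * \<alpha>) * (norm (g x))\<^sup>2 + t / (2 * \<beta>) * (norm (h x))\<^sup>2"
      unfolding sumK norms by (simp add: c_def g0_def sum_distrib_left)
    moreover have "t * norm (g x) \<le> t * ((norm (g x))\<^sup>2 / (2 * \<alpha>) + \<alpha> / 2)"
      "t * norm (h x) \<le> t * ((norm (h x))\<^sup>2 / (2 * \<beta>) + \<beta> / 2)"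
      using amgm \<alpha>\<beta> t by (auto intro!: mult_left_mono)
    ultimately have "t * (norm (g x) + norm (h x)) \<le> t * (\<alpha> + \<beta>) / 2 + (\<Sum>k\<in>K. c k * (x k)\<^sup>2)"
      by (simp add: algebra_simps add_divide_distrib)
    thus ?thesis using finK by (simp add: G_def exp_sum[symmetric] mult_exp_exp)
  qed
  \<comment> \<open>With r = sqrt n the base is the square root of 1 + t / r, hence at most exp (t /
    (2 r)); as n = r^2, its n-th power is at most exp (t r / 2).\<close>
  have chi: "(1 / sqrt (1 - t / (sqrt (real n) + t))) ^ n \<le> exp (t * sqrt (real n) / 2)" if "0 < n" for n
  proof -
    define r where "r = sqrt (real n)"
    have r: "0 < r" using that by (simp add: r_def)
    have "1 - t / (r + t) = inverse (1 + t / r)"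
      using r t by (simp add: field_simps)
    hence "1 / sqrt (1 - t / (r + t)) = sqrt (1 + t / r)"
      by (simp add: real_sqrt_inverse divide_inverse)
    also have "\<dots> \<le> sqrt (exp (t / r))" by simp
    also have "\<dots> = exp (t / r / 2)"
      by (rule real_sqrt_unique) (auto simp: exp_double[symmetric])
    finally have "(1 / sqrt (1 - t / (r + t))) ^ n \<le> exp (t / r / 2) ^ n"
      using r t by (intro power_mono) (auto simp: field_simps)
    also have "\<dots> = exp (real n * (t / r / 2))" by (rule exp_of_nat_mult[symmetric])
    also have "real n = r\<^sup>2" by (simp add: r_def)
    also have "r\<^sup>2 * (t / r / 2) = t * r / 2"
      using r by (simp add: field_simps power2_eq_square)
    finally show ?thesis by (simp add: r_def)
  qed
  have chi0: "0 \<le> (1 / sqrt (1 - t / (sqrt (real n) + t))) ^ n" for n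
    using t by (intro zero_le_power) (simp add: divide_le_eq_1 add_nonneg_pos)
  \<comment> \<open>The summand \<open>t\<close> in \<alpha> and \<beta> keeps t / \<alpha> and t /
    \<beta> below 1, so the chi-square moments are finite.\<close>
  have c_half: "c k < 1 / 2" for k
    using t \<alpha>\<beta> by (auto simp: c_def \<alpha>_def \<beta>_def field_simps split: sum.split)
  have "(\<integral>\<^sup>+x. ennreal (G x) \<partial>Pi\<^sub>M K (\<lambda>_. std_gauss))
      \<le> (\<integral>\<^sup>+x. ennreal (exp (t * (\<alpha> + \<beta>) / 2)) * (\<Prod>k\<in>K. ennreal (exp (c k * (x k)\<^sup>2))) \<partial>Pi\<^sub>M K (\<lambda>_. std_gauss))"
    using G_le by (intro nn_integral_mono)
      (simp add: prod_ennreal ennreal_mult[symmetric] prod_nonneg ennreal_leI)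
  also have "\<dots> = ennreal (exp (t * (\<alpha> + \<beta>) / 2)) *
      (\<integral>\<^sup>+x. (\<Prod>k\<in>K. ennreal (exp (c k * (x k)\<^sup>2))) \<partial>Pi\<^sub>M K (\<lambda>_. std_gauss))"
    using comp by (intro nn_integral_cmult borel_measurable_prod_ennreal) simp
  also have "(\<integral>\<^sup>+x. (\<Prod>k\<in>K. ennreal (exp (c k * (x k)\<^sup>2))) \<partial>Pi\<^sub>M K (\<lambda>_. std_gauss))
      = (\<Prod>k\<in>K. ennreal (1 / sqrt (1 - 2 * c k)))"
    using S.product_nn_integral_prod[OF finK(2), of "\<lambda>k y. ennreal (exp (c k * y\<^sup>2))"] c_half
    by (simp add: nn_integral_std_gauss_exp_square)
  also have "\<dots> = ennreal (\<Prod>k\<in>K. 1 / sqrt (1 - 2 * c k))"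
  proof (rule prod_ennreal)
    show "0 \<le> 1 / sqrt (1 - 2 * c k)" for k using c_half[of k] by simp
  qed
  also have "(\<Prod>k\<in>K. 1 / sqrt (1 - 2 * c k))
      = (1 / sqrt (1 - t / \<alpha>)) ^ CARD('k) * (1 / sqrt (1 - t / \<beta>)) ^ CARD('m)"
    using fin by (simp add: K_Plus prod.Plus c_def del: UNIV_Plus_UNIV)
  also have "ennreal (exp (t * (\<alpha> + \<beta>) / 2)) * ennreal \<dots>
      \<le> ennreal (exp (t * (\<alpha> + \<beta>) / 2)) * ennreal (exp (t * sqrt (real CARD('k)) / 2) * exp (t * sqrt (real CARD('m)) / 2))"
    unfolding \<alpha>_def \<beta>_def using t
    by (intro mult_left_mono ennreal_leI mult_mono chi chi0) auto
  \<comment> \<open>The term t (\<alpha> + \<beta>) / 2 is half of the linear term plus t^2; the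
    chi-square factors give the other half of the linear term.\<close>
  also have "\<dots> = ennreal (exp (t * (sqrt (real CARD('k)) + sqrt (real CARD('m))) + t\<^sup>2))"
    by (simp add: ennreal_mult[symmetric] mult_exp_exp \<alpha>_def \<beta>_def) (simp add: field_simps power2_eq_square)
  finally have G_int: "(\<integral>\<^sup>+x. ennreal (G x) \<partial>Pi\<^sub>M K (\<lambda>_. std_gauss))
      \<le> ennreal (exp (t * (sqrt (real CARD('k)) + sqrt (real CARD('m))) + t\<^sup>2))" .

  define s where "s = sqrt (real CARD('k)) + sqrt (real CARD('m)) + t"
  \<comment> \<open>The factor exp (t^2 / 2) of the auxiliary scalar is divided out, and t (s - t) +
    t^2 - t^2 / 2 = t s - t^2 / 2.\<close>
  have MX_int: "(\<integral>\<^sup>+x. ennreal (MX x) \<partial>Pi\<^sub>M K' (\<lambda>_. std_gauss)) \<le> ennreal (exp (t * s - t\<^sup>2 / 2))"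
  proof -
    let ?J = "\<integral>\<^sup>+x. ennreal (MX x) \<partial>Pi\<^sub>M K' (\<lambda>_. std_gauss)"
    have "?J = ?J * ennreal (exp (t\<^sup>2 / 2)) * ennreal (exp (- (t\<^sup>2 / 2)))"
      by (simp add: mult.assoc ennreal_mult[symmetric] mult_exp_exp)
    also have "\<dots> \<le> ennreal (exp (t * (sqrt (real CARD('k)) + sqrt (real CARD('m))) + t\<^sup>2)) * ennreal (exp (- (t\<^sup>2 / 2)))"
      by (intro mult_right_mono order.trans[OF main G_int]) auto
    also have "\<dots> = ennreal (exp (t * s - t\<^sup>2 / 2))"
      by (simp add: ennreal_mult[symmetric] mult_exp_exp s_def) (simp add: field_simps power2_eq_square)
    finally show ?thesis .
  qed
  let ?P = "Pi\<^sub>M K' (\<lambda>_. std_gauss)"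
  have reindex: "\<mu> = distr ?P \<mu> (\<lambda>x. \<lambda>n\<in>L \<times> UNIV. x (Inl n))"
    unfolding \<mu>_def
    by (rule distr_PiM_reindex[symmetric]) (auto simp: prob_space_std_gauss K'_def)
  have rm: "(\<lambda>x. \<lambda>n\<in>L \<times> UNIV. x (Inl n)) \<in> measurable ?P \<mu>"
    unfolding \<mu>_def
  proof (intro measurable_restrict)
    fix n :: "'l \<times> 'm" assume "n \<in> L \<times> UNIV"
    hence "Inl n \<in> K'" by (auto simp: K'_def)
    thus "(\<lambda>x. x (Inl n)) \<in> measurable ?P std_gauss" by (rule measurable_component_singleton)
  qed
  let ?E = "{x \<in> space \<mu>. \<exists>i\<in>I. (\<Sum>l\<in>L. \<Sum>m\<in>UNIV. Q i l * v i $ m * x (l, m)) > s}"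
  have [measurable]: "(\<lambda>x. x (l, m)) \<in> borel_measurable \<mu>" if "l \<in> L" for l m
    using integrable_std_gauss_component[of "L \<times> (UNIV :: 'm set)" "(l, m)"] fin that
    unfolding \<mu>_def by auto
  have E: "?E \<in> sets \<mu>" using fin by measurable
  have "emeasure \<mu> ?E = emeasure ?P ((\<lambda>x. \<lambda>n\<in>L \<times> UNIV. x (Inl n)) -` ?E \<inter> space ?P)"
    by (subst reindex, rule emeasure_distr[OF rm E])
  \<comment> \<open>Chernoff bound with exponent \<open>t\<close>: the factor exp (- t s) cancels t
    s in the moment bound.\<close>
  also have "\<dots> \<le> emeasure ?P {x \<in> space ?P. 1 \<le> ennreal (exp (- t * s)) * ennreal (MX x)}"
  proof (intro emeasure_mono subsetI)
    fix x assume x: "x \<in> (\<lambda>x. \<lambda>n\<in>L \<times> UNIV. x (Inl n)) -` ?E \<inter> space ?P"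
    then obtain i where i: "i \<in> I" "s < X i x" by (auto simp: X_def)
    have "t * s \<le> t * X i x" using i t by simp
    hence "1 \<le> exp (- t * s) * exp (t * X i x)" by (simp add: mult_exp_exp)
    also have "\<dots> \<le> exp (- t * s) * MX x" by (intro mult_left_mono MX_ge i) simp
    finally show "x \<in> {x \<in> space ?P. 1 \<le> ennreal (exp (- t * s)) * ennreal (MX x)}"
      using x MX0 by (simp add: ennreal_mult[symmetric] flip: ennreal_1)
  qed measurable
  also have "\<dots> \<le> ennreal (exp (- t * s)) * (\<integral>\<^sup>+x. ennreal (MX x) * indicator (space ?P) x \<partial>?P)"
    by (rule nn_integral_Markov_inequality) auto
  also have "(\<integral>\<^sup>+x. ennreal (MX x) * indicator (space ?P) x \<partial>?P) = (\<integral>\<^sup>+x. ennreal (MX x) \<partial>?P)"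
    by (intro nn_integral_cong) simp
  also have "ennreal (exp (- t * s)) * \<dots> \<le> ennreal (exp (- t * s)) * ennreal (exp (t * s - t\<^sup>2 / 2))"
    by (intro mult_left_mono MX_int) simp
  also have "\<dots> = ennreal (exp (- t\<^sup>2 / 2))" by (simp add: ennreal_mult[symmetric] mult_exp_exp)
  finally show ?thesis unfolding s_def by (simp add: measure_def enn2real_leI)
qed

section \<open>Noise on a fixed design, uniformly over all test pairs\<close>

text \<open>Compresses a design of any number of samples to a linear map on the regressor space with
  the same Gram form. A new sample appends one coordinate; the range of the extended map has
  dimension at most that of \<open>'a\<close>, so it embeds isometrically back into
  \<open>'a\<close>.\<close>

lemma gram_factorization:
  fixes z :: "'l \<Rightarrow> 'a::euclidean_space"
  assumes "finite L"
  shows "\<exists>S :: 'a \<Rightarrow> 'a. linear S \<and> (\<forall>q q'. S q \<bullet> S q' = (\<Sum>l\<in>L. (z l \<bullet> q) * (z l \<bullet> q')))"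
  using assms
proof (induction L)
  case empty
  show ?case by (rule exI[of _ "\<lambda>_. 0"]) (simp add: linear_zero)
next
  case (insert l L)
  then obtain S :: "'a \<Rightarrow> 'a" where S: "linear S"
    "\<And>q q'. S q \<bullet> S q' = (\<Sum>l\<in>L. (z l \<bullet> q) * (z l \<bullet> q'))" by blast
  define T where "T q = (S q, z l \<bullet> q)" for q
  have T: "linear T"
    unfolding T_def using S(1)
    by (intro linearI) (simp_all add: linear_add linear_scale inner_add_right)
  have "dim (range T) \<le> dim (UNIV :: 'a set)" by (rule dim_image_le[OF T])
  then obtain f :: "'a \<times> real \<Rightarrow> 'a" where f: "linear f" "\<And>x. x \<in> range T \<Longrightarrow> norm (f x) = norm x"
    by (rule isometry_subset_subspace[OF linear_subspace_image[OF T subspace_UNIV] subspace_UNIV]) auto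
  \<comment> \<open>Polarization: inner products are determined by norms, and the range of
    \<open>T\<close> is closed under sums.\<close>
  have "f (T q) \<bullet> f (T q') = T q \<bullet> T q'" for q q'
  proof -
    have "norm (f (T q) + f (T q')) = norm (T q + T q')"
      using f(2)[OF rangeI, of "q + q'"] by (simp only: linear_add[OF T] linear_add[OF f(1)])
    thus ?thesis using f(2) by (simp add: dot_norm)
  qed
  hence "f (T q) \<bullet> f (T q') = (\<Sum>l\<in>insert l L. (z l \<bullet> q) * (z l \<bullet> q'))" for q q'
    using insert.hyps by (simp add: T_def S(2) add.commute)
  thus ?case using linear_compose[OF T f(1)] by (intro exI[of _ "f \<circ> T"]) (simp add: o_def)
qed

text \<open>The bad event contains no matrix inverse: it says that the noise, tested against the pair
  \<open>(q, v)\<close>, exceeds \<open>c\<close> on the row space of the design \<open>z\<close>, and is meaningful for singular designs too.\<close>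

definition noise_bad :: "'l set \<Rightarrow> real \<Rightarrow> ('l \<Rightarrow> real^'k) \<Rightarrow> ('l \<times> 'm \<Rightarrow> real) \<Rightarrow> (real^'k) \<times> (real^'m) \<Rightarrow> bool" where
  "noise_bad L c z x = (\<lambda>(q, v). c * sqrt (\<Sum>l\<in>L. (z l \<bullet> q)\<^sup>2) * norm v
     < (\<Sum>l\<in>L. \<Sum>m\<in>UNIV. (z l \<bullet> q) * v $ m * x (l, m)))"

text \<open>Strict inequality between continuous functions makes the bad pairs an open set, which a
  dense set meets once it is nonempty. For countable \<open>D\<close> this makes the quantifier over
  all pairs measurable.\<close>

lemma noise_bad_dense:
  assumes D: "\<And>X :: ((real^'k) \<times> (real^'m)) set. open X \<Longrightarrow> X \<noteq> {} \<Longrightarrow> \<exists>d\<in>D. d \<in> X"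
  shows "(\<exists>p. noise_bad L c z x p) \<longleftrightarrow> (\<exists>p\<in>D. noise_bad L c z x p)"
proof
  assume "\<exists>p. noise_bad L c z x p"
  moreover have "open {p. noise_bad L c z x p}"
    unfolding noise_bad_def split_beta by (intro open_Collect_less continuous_intros)
  ultimately show "\<exists>p\<in>D. noise_bad L c z x p" using D[of "{p. noise_bad L c z x p}"] by auto
qed blast

text \<open>Enumerating a countable dense set writes the event as an increasing union of events
  about finitely many pairs, each bounded by \<open>gaussian_bilinear_tail\<close> after normalising
  the pairs.\<close>

lemma noise_bad_tail:
  fixes z :: "'l \<Rightarrow> real^'k"
  assumes L: "finite L" and t: "0 \<le> t"
  defines "\<mu> \<equiv> Pi\<^sub>M (L \<times> (UNIV :: 'm::finite set)) (\<lambda>_. std_gauss)"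
    and "c \<equiv> sqrt (real CARD('k)) + sqrt (real CARD('m)) + t"
  shows "measure \<mu> {x \<in> space \<mu>. \<exists>p. noise_bad L c z x p} \<le> exp (- t\<^sup>2 / 2)"
proof -
  interpret prob_space \<mu>
    unfolding \<mu>_def by (intro prob_space_PiM prob_space_std_gauss)
  have [measurable]: "(\<lambda>x. x (l, m)) \<in> borel_measurable \<mu>" if "l \<in> L" for l m
    using integrable_std_gauss_component[of "L \<times> (UNIV :: 'm set)" "(l, m)"] L that
    unfolding \<mu>_def by auto
  obtain S :: "real^'k \<Rightarrow> real^'k" where S: "\<And>q q'. S q \<bullet> S q' = (\<Sum>l\<in>L. (z l \<bullet> q) * (z l \<bullet> q'))"
    using gram_factorization[OF L] by blast
  have normS: "norm (S q) = sqrt (\<Sum>l\<in>L. (z l \<bullet> q)\<^sup>2)" for q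
    by (simp add: norm_eq_sqrt_inner S power2_eq_square)
  obtain D :: "((real^'k) \<times> (real^'m)) set" where D: "countable D"
    "\<And>X. open X \<Longrightarrow> X \<noteq> {} \<Longrightarrow> \<exists>d\<in>D. d \<in> X" by (rule countable_dense_setE) blast
  have "D \<noteq> {}" using D(2)[of UNIV] by auto
  define d where "d = from_nat_into D"
  have ranged: "range d = D" unfolding d_def by (rule range_from_nat_into) fact+
  define A where "A n = {x \<in> space \<mu>. \<exists>i\<in>{..n}. noise_bad L c z x (d i)}" for n :: nat
  have bad_meas[measurable]: "{x \<in> space \<mu>. noise_bad L c z x p} \<in> sets \<mu>" for p
    unfolding noise_bad_def split_beta using L by measurable
  have A_sets: "A n \<in> sets \<mu>" for n
    unfolding A_def by (intro sets.sets_Collect_finite_Ex bad_meas) auto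
  have A_le: "measure \<mu> (A n) \<le> exp (- t\<^sup>2 / 2)" for n
  proof -
    \<comment> \<open>Pairs that cannot be normalised are dropped; they are never bad, since both
      sides of the strict inequality are then 0.\<close>
    define I where "I = {i \<in> {..n}. S (fst (d i)) \<noteq> 0 \<and> snd (d i) \<noteq> 0}"
    define q v where "q i = S (fst (d i)) /\<^sub>R norm (S (fst (d i)))"
      and "v i = snd (d i) /\<^sub>R norm (snd (d i))" for i
    define Q where "Q i l = (z l \<bullet> fst (d i)) / norm (S (fst (d i)))" for i l
    let ?E = "{x \<in> space \<mu>. \<exists>i\<in>I. (\<Sum>l\<in>L. \<Sum>m\<in>UNIV. Q i l * v i $ m * x (l, m)) > c}"
    have "measure \<mu> (A n) \<le> measure \<mu> ?E"
    proof (intro finite_measure_mono subsetI)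
      fix x assume "x \<in> A n"
      then obtain i where x: "x \<in> space \<mu>" and i: "i \<le> n" "noise_bad L c z x (d i)"
        by (auto simp: A_def)
      have bad: "c * norm (S (fst (d i))) * norm (snd (d i))
          < (\<Sum>l\<in>L. \<Sum>m\<in>UNIV. (z l \<bullet> fst (d i)) * snd (d i) $ m * x (l, m))"
        using i(2) by (simp add: noise_bad_def split_beta normS)
      have "S (fst (d i)) \<noteq> 0"
      proof
        assume "S (fst (d i)) = 0"
        hence "norm (S (fst (d i))) = 0" by simp
        hence "(\<Sum>l\<in>L. (z l \<bullet> fst (d i))\<^sup>2) = 0" unfolding normS by simp
        hence "z l \<bullet> fst (d i) = 0" if "l \<in> L" for l
          using that L by (subst (asm) sum_nonneg_eq_0_iff) auto
        thus False using bad \<open>S (fst (d i)) = 0\<close> by simp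
      qed
      moreover have "snd (d i) \<noteq> 0" using bad by auto
      ultimately have nz: "S (fst (d i)) \<noteq> 0" "snd (d i) \<noteq> 0" by auto
      have "(\<Sum>l\<in>L. \<Sum>m\<in>UNIV. Q i l * v i $ m * x (l, m))
         = (\<Sum>l\<in>L. \<Sum>m\<in>UNIV. (z l \<bullet> fst (d i)) * snd (d i) $ m * x (l, m))
           / (norm (S (fst (d i))) * norm (snd (d i)))"
        by (simp add: Q_def v_def sum_distrib_left divide_inverse mult_ac)
      also have "\<dots> > c" using bad nz by (simp add: pos_less_divide_eq mult_ac)
      finally show "x \<in> ?E" using x i(1) nz by (auto simp: I_def)
    next
      have "finite I" by (simp add: I_def)
      thus "?E \<in> sets \<mu>" using L by measurable
    qed
    also have "\<dots> \<le> exp (- t\<^sup>2 / 2)"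
      unfolding c_def \<mu>_def
    proof (rule gaussian_bilinear_tail[OF _ L _ _ _ t, where p = q])
      show "(\<Sum>l\<in>L. Q i l * Q j l) = q i \<bullet> q j" for i j
        by (simp add: Q_def q_def S sum_distrib_left divide_inverse mult_ac)
    qed (auto simp: I_def q_def v_def)
    finally show ?thesis .
  qed
  have dense: "(\<exists>p. noise_bad L c z x p) \<longleftrightarrow> (\<exists>p\<in>D. noise_bad L c z x p)" for x
    by (rule noise_bad_dense) (rule D(2))
  have "{x \<in> space \<mu>. \<exists>p. noise_bad L c z x p} = (\<Union>n. A n)"
    unfolding dense ranged[symmetric] by (auto simp: A_def)
  moreover have "incseq A"
  proof (rule monoI)
    fix m n :: nat assume "m \<le> n"
    show "A m \<subseteq> A n"
    proof
      fix x assume "x \<in> A m"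
      then obtain i where "x \<in> space \<mu>" "i \<le> m" "noise_bad L c z x (d i)" by (auto simp: A_def)
      thus "x \<in> A n" using \<open>m \<le> n\<close> by (auto simp: A_def intro!: bexI[of _ i])
    qed
  qed
  hence "(\<lambda>n. measure \<mu> (A n)) \<longlonglongrightarrow> measure \<mu> (\<Union>n. A n)"
    using A_sets by (intro finite_Lim_measure_incseq) auto
  ultimately show ?thesis using A_le by (auto intro: LIMSEQ_le_const2)
qed

section \<open>The law of the noise\<close>

lemma matrix_inv_right:
  fixes G :: "real^'n^'n"
  assumes "invertible G"
  shows "G ** matrix_inv G = mat 1"
  using assms unfolding matrix_inv_def invertible_def by (rule someI2_ex) auto

lemma matrix_inv_unique:
  fixes G :: "real^'n^'n"
  assumes "G ** H = mat 1"
  shows "matrix_inv G = H"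
proof -
  have HG: "H ** G = mat 1" using assms matrix_left_right_inverse by blast
  hence "invertible G" using assms unfolding invertible_def by blast
  hence "H ** (G ** matrix_inv G) = H" by (simp add: matrix_inv_right)
  thus ?thesis by (simp add: matrix_mul_assoc HG)
qed

text \<open>For a scalar covariance the quadratic form and the determinant split over coordinates;
  this is what makes the entries of one noise vector independent.\<close>

lemma mv_normal_density_isotropic:
  fixes v :: "real^'n"
  assumes "0 < \<sigma>"
  shows "mv_normal_density 0 (\<sigma>\<^sup>2 *\<^sub>R mat 1) v = (\<Prod>i\<in>UNIV. normal_density 0 \<sigma> (v $ i))"
proof -
  have inv: "matrix_inv (\<sigma>\<^sup>2 *\<^sub>R mat 1 :: real^'n^'n) = (1 / \<sigma>\<^sup>2) *\<^sub>R mat 1"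
    using assms by (intro matrix_inv_unique)
      (simp add: scalar_matrix_assoc[symmetric] matrix_scalar_ac)
  have "det (\<sigma>\<^sup>2 *\<^sub>R mat 1 :: real^'n^'n) = (\<sigma>\<^sup>2) ^ CARD('n)"
    by (subst det_diagonal) (auto simp: mat_def)
  hence det: "sqrt ((2 * pi) ^ CARD('n) * det (\<sigma>\<^sup>2 *\<^sub>R mat 1 :: real^'n^'n)) = sqrt (2 * pi * \<sigma>\<^sup>2) ^ CARD('n)"
    by (simp only: power_mult_distrib[symmetric] real_sqrt_power)
  have "- (v \<bullet> (matrix_inv (\<sigma>\<^sup>2 *\<^sub>R mat 1) *v v)) / 2 = (\<Sum>i\<in>UNIV. - (v $ i)\<^sup>2 / (2 * \<sigma>\<^sup>2))"
  proof -
    have "v \<bullet> v = (\<Sum>i\<in>UNIV. (v $ i)\<^sup>2)" by (simp add: inner_vec_def power2_eq_square)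
    thus ?thesis
      unfolding inv sum_divide_distrib[symmetric] sum_negf
      by (simp add: scaleR_matrix_vector_assoc[symmetric] field_simps)
  qed
  thus ?thesis
    unfolding mv_normal_density_def det diff_zero
    by (simp add: normal_density_def prod_dividef exp_sum)
qed

lemma emeasure_std_gauss_scaled:
  assumes "0 < \<sigma>" and [measurable]: "E \<in> sets borel"
  shows "(\<integral>\<^sup>+y. ennreal (normal_density 0 \<sigma> y) * indicator E (y / \<sigma>) \<partial>lborel) = emeasure std_gauss E"
proof -
  have dens: "\<sigma> * normal_density 0 \<sigma> (\<sigma> * y) = std_normal_density y" for y
    using assms(1) by (simp add: normal_density_def power_mult_distrib real_sqrt_mult)
  have "(\<integral>\<^sup>+y. ennreal (normal_density 0 \<sigma> y) * indicator E (y / \<sigma>) \<partial>lborel)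
      = \<sigma> * (\<integral>\<^sup>+y. ennreal (normal_density 0 \<sigma> (\<sigma> * y)) * indicator E y \<partial>lborel)"
    using assms(1) by (subst nn_integral_real_affine[where c=\<sigma> and t=0]) auto
  also have "\<dots> = (\<integral>\<^sup>+y. ennreal (\<sigma> * normal_density 0 \<sigma> (\<sigma> * y)) * indicator E y \<partial>lborel)"
    using assms(1) by (subst nn_integral_cmult[symmetric]) (auto simp: ennreal_mult mult.assoc)
  also have "\<dots> = emeasure std_gauss E"
    unfolding dens std_gauss_def by (subst emeasure_density) auto
  finally show ?thesis .
qed

text \<open>On a box both density and indicator factor over coordinates, so the Lebesgue integral
  splits into one-dimensional ones, each standardised by the substitution y = \<sigma> y'.\<close>

lemma (in prob_space) emeasure_normal_box:
  fixes w :: "'a \<Rightarrow> real^'n"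
  assumes \<sigma>: "0 < \<sigma>"
    and w: "distributed M lborel w (\<lambda>v. ennreal (mv_normal_density 0 (\<sigma>\<^sup>2 *\<^sub>R mat 1) v))"
    and E: "\<And>i. E i \<in> sets borel"
  shows "emeasure M (w -` {v. \<forall>i. v $ i / \<sigma> \<in> E i} \<inter> space M) = (\<Prod>i\<in>UNIV. emeasure std_gauss (E i))"
proof -
  note E[measurable]
  have comp[measurable]: "(\<lambda>v :: real^'n. v $ i) \<in> borel_measurable borel" for i
    by (intro borel_measurable_continuous_onI continuous_intros)
  have "{v :: real^'n. \<forall>i. v $ i / \<sigma> \<in> E i} = {v \<in> space borel. \<forall>i\<in>UNIV. v $ i / \<sigma> \<in> E i}" by simp
  also have "\<dots> \<in> sets borel" by measurable
  finally have box: "{v :: real^'n. \<forall>i. v $ i / \<sigma> \<in> E i} \<in> sets lborel" by simp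
  have Basis: "(Basis :: (real^'n) set) = range (\<lambda>i. axis i 1)" by (auto simp: Basis_vec_def)
  have inj: "inj (\<lambda>i. axis i (1::real) :: real^'n)" by (auto simp: inj_on_def axis_eq_axis)
  define f where "f b y = ennreal (normal_density 0 \<sigma> y) * indicator (E (axis_index b)) (y / \<sigma>)"
    for b :: "real^'n" and y
  have "emeasure M (w -` {v. \<forall>i. v $ i / \<sigma> \<in> E i} \<inter> space M)
     = (\<integral>\<^sup>+v. ennreal (mv_normal_density 0 (\<sigma>\<^sup>2 *\<^sub>R mat 1) v) * indicator {v. \<forall>i. v $ i / \<sigma> \<in> E i} v \<partial>lborel)"
    by (rule distributed_emeasure[OF w box])
  also have "\<dots> = (\<integral>\<^sup>+v. (\<Prod>b\<in>Basis. f b (v \<bullet> b)) \<partial>lborel)"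
  proof (rule nn_integral_cong)
    fix v :: "real^'n"
    have "(\<Prod>b\<in>Basis. f b (v \<bullet> b))
        = (\<Prod>i\<in>UNIV. ennreal (normal_density 0 \<sigma> (v $ i)) * indicator (E i) (v $ i / \<sigma>))"
      unfolding Basis by (subst prod.reindex[OF inj]) (simp add: f_def inner_axis)
    also have "\<dots> = ennreal (mv_normal_density 0 (\<sigma>\<^sup>2 *\<^sub>R mat 1) v) * (\<Prod>i\<in>UNIV. indicator (E i) (v $ i / \<sigma>))"
      by (simp add: prod.distrib prod_ennreal mv_normal_density_isotropic[OF \<sigma>])
    also have "(\<Prod>i\<in>UNIV. indicator (E i) (v $ i / \<sigma>)) = (indicator {v. \<forall>i. v $ i / \<sigma> \<in> E i} v :: ennreal)"
      by (auto simp: indicator_def prod_zero_iff intro!: prod.neutral)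
    finally show "ennreal (mv_normal_density 0 (\<sigma>\<^sup>2 *\<^sub>R mat 1) v) * indicator {v. \<forall>i. v $ i / \<sigma> \<in> E i} v
        = (\<Prod>b\<in>Basis. f b (v \<bullet> b))" by simp
  qed
  also have "\<dots> = (\<Prod>b\<in>Basis. \<integral>\<^sup>+y. f b y \<partial>lborel)"
    by (rule nn_integral_lborel_prod) (auto simp: f_def)
  also have "\<dots> = (\<Prod>i\<in>UNIV. emeasure std_gauss (E i))"
    unfolding Basis by (subst prod.reindex[OF inj])
      (simp add: f_def[abs_def] emeasure_std_gauss_scaled[OF \<sigma> E])
  finally show ?thesis .
qed

text \<open>A product measure is determined by rectangles. There independence of the samples yields
  the product over \<open>l\<close>, and the box formula the product over the entries of each noise
  vector.\<close>

lemma (in prob_space) distr_normalized_noise: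
  fixes w :: "'l \<Rightarrow> 'a \<Rightarrow> real^'n"
  assumes L: "finite L" "L \<noteq> {}" and \<sigma>: "0 < \<sigma>"
    and indep: "indep_vars (\<lambda>_. borel) w L"
    and w: "\<And>l. l \<in> L \<Longrightarrow> distributed M lborel (w l) (\<lambda>v. ennreal (mv_normal_density 0 (\<sigma>\<^sup>2 *\<^sub>R mat 1) v))"
  shows "distr M (Pi\<^sub>M (L \<times> UNIV) (\<lambda>_. std_gauss)) (\<lambda>\<omega>. \<lambda>n\<in>L \<times> UNIV. w (fst n) \<omega> $ (snd n) / \<sigma>)
       = Pi\<^sub>M (L \<times> UNIV) (\<lambda>_. std_gauss)"
proof -
  interpret S: product_prob_space "\<lambda>_::'l \<times> 'n. std_gauss" "L \<times> UNIV" by (rule product_prob_space_std_gauss)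
  let ?\<xi> = "\<lambda>\<omega>. \<lambda>n\<in>L \<times> UNIV. w (fst n) \<omega> $ (snd n) / \<sigma>"
  have comp[measurable]: "(\<lambda>v :: real^'n. v $ i) \<in> borel_measurable borel" for i
    by (intro borel_measurable_continuous_onI continuous_intros)
  have wm: "w l \<in> borel_measurable M" if "l \<in> L" for l
    using indep that by (auto simp: indep_vars_def)
  have \<xi>m: "?\<xi> \<in> measurable M (Pi\<^sub>M (L \<times> UNIV) (\<lambda>_. std_gauss))"
  proof (intro measurable_restrict)
    fix n :: "'l \<times> 'n" assume "n \<in> L \<times> UNIV"
    hence [measurable]: "w (fst n) \<in> borel_measurable M" using wm by auto
    show "(\<lambda>\<omega>. w (fst n) \<omega> $ snd n / \<sigma>) \<in> measurable M std_gauss" by measurable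
  qed
  show ?thesis
  proof (rule S.PiM_eqI)
    fix A :: "'l \<times> 'n \<Rightarrow> real set" assume A: "\<And>n. n \<in> L \<times> UNIV \<Longrightarrow> A n \<in> sets std_gauss"
    define B where "B l = {v :: real^'n. \<forall>i. v $ i / \<sigma> \<in> A (l, i)}" for l
    have B: "B l \<in> sets borel" if "l \<in> L" for l
    proof -
      have [measurable]: "A (l, i) \<in> sets borel" for i using A[of "(l, i)"] that by simp
      have "B l = {v \<in> space borel. \<forall>i\<in>UNIV. v $ i / \<sigma> \<in> A (l, i)}" by (simp add: B_def)
      also have "\<dots> \<in> sets borel" by measurable
      finally show ?thesis .
    qed
    have "emeasure (distr M (Pi\<^sub>M (L \<times> UNIV) (\<lambda>_. std_gauss)) ?\<xi>) (Pi\<^sub>E (L \<times> UNIV) A)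
        = emeasure M (?\<xi> -` Pi\<^sub>E (L \<times> UNIV) A \<inter> space M)"
      using A L by (intro emeasure_distr \<xi>m sets_PiM_I_finite) auto
    also have "?\<xi> -` Pi\<^sub>E (L \<times> UNIV) A \<inter> space M = (\<Inter>l\<in>L. w l -` B l \<inter> space M)"
      using L by (auto simp: B_def PiE_iff)
    also have "emeasure M \<dots> = (\<Prod>l\<in>L. emeasure M (w l -` B l \<inter> space M))"
      using indep_varsD_finite[OF indep L(2,1) B]
      by (simp add: emeasure_eq_measure prod_ennreal)
    also have "\<dots> = (\<Prod>l\<in>L. \<Prod>i\<in>UNIV. emeasure std_gauss (A (l, i)))"
      unfolding B_def using A by (intro prod.cong refl emeasure_normal_box[OF \<sigma> w]) auto
    also have "\<dots> = (\<Prod>n\<in>L \<times> UNIV. emeasure std_gauss (A n))"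
      by (simp add: prod.cartesian_product split_def)
    finally show "emeasure (distr M (Pi\<^sub>M (L \<times> UNIV) (\<lambda>_. std_gauss)) ?\<xi>) (Pi\<^sub>E (L \<times> UNIV) A)
        = (\<Prod>n\<in>L \<times> UNIV. emeasure std_gauss (A n))" .
  qed (use L in auto)
qed

section \<open>Least squares\<close>

lemma sum_UNIV_Plus:
  "(\<Sum>k\<in>(UNIV :: ('a::finite + 'b::finite) set). f k) = (\<Sum>i\<in>UNIV. f (Inl i)) + (\<Sum>j\<in>UNIV. f (Inr j))"
  by (simp flip: UNIV_Plus_UNIV add: sum.Plus)

lemma vstack_nth [simp]: "vstack x u $ Inl i = x $ i" "vstack x u $ Inr j = u $ j"
  by (simp_all add: vstack_def)

lemma vstack_inner: "vstack x u \<bullet> vstack x' u' = x \<bullet> x' + u \<bullet> u'"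
  by (simp add: inner_vec_def sum_UNIV_Plus)

lemma vstack_exhaust: "\<exists>x u. q = vstack x u"
proof -
  have "q = vstack (\<chi> i. q $ Inl i) (\<chi> j. q $ Inr j)"
    by (simp add: vec_eq_iff vstack_def split: sum.split)
  thus ?thesis by blast
qed

lemma hstack_mult_vstack: "hstack X Y *v vstack x u = X *v x + Y *v u"
  by (simp add: vec_eq_iff hstack_def matrix_vector_mult_def sum_UNIV_Plus)

lemma transpose_Q\<^sub>A: "transpose Q\<^sub>A *v a = vstack a 0"
  unfolding vec_eq_iff
proof
  show "(transpose Q\<^sub>A *v a) $ k = vstack a 0 $ k" for k :: "'a + 'b"
    by (cases k) (simp_all add: Q\<^sub>A_def hstack_def transpose_def matrix_vector_mult_def mat_def mult_delta_left)
qed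

lemma transpose_Q\<^sub>B: "transpose Q\<^sub>B *v b = vstack 0 b"
  unfolding vec_eq_iff
proof
  show "(transpose Q\<^sub>B *v b) $ k = vstack 0 b $ k" for k :: "'a + 'b"
    by (cases k) (simp_all add: Q\<^sub>B_def hstack_def transpose_def matrix_vector_mult_def mat_def mult_delta_left)
qed

lemma gram_nth:
  "gram N x u $ i $ j = (\<Sum>l = 1..N. vstack (x l) (u l) $ i * vstack (x l) (u l) $ j)"
  by (simp add: gram_def Let_def matrix_matrix_mult_def columnvector_def rowvector_def)

lemma gram_mult: "gram N x u *v q = (\<Sum>l = 1..N. (vstack (x l) (u l) \<bullet> q) *\<^sub>R vstack (x l) (u l))"
proof -
  have "(\<Sum>j\<in>UNIV. (\<Sum>l = 1..N. vstack (x l) (u l) $ i * vstack (x l) (u l) $ j) * q $ j)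
      = (\<Sum>l = 1..N. (vstack (x l) (u l) \<bullet> q) * vstack (x l) (u l) $ i)" for i
    unfolding sum_distrib_right inner_vec_def by (subst sum.swap) (simp add: mult_ac)
  thus ?thesis by (simp add: vec_eq_iff matrix_vector_mult_def gram_nth)
qed

text \<open>At s = b / (c + 1) the quadratic equals - s^2 (c + 2), which is negative unless b = 0;
  the added 1 keeps the denominator positive when c = 0.\<close>

lemma nonneg_quadratic_linear_coeff:
  fixes b c :: real
  assumes c: "0 \<le> c" and nonneg: "\<And>s. 0 \<le> s\<^sup>2 * c - 2 * s * b"
  shows "b = 0"
proof (rule ccontr)
  assume "b \<noteq> 0"
  define s where "s = b / (c + 1)"
  have b: "b = s * (c + 1)" using c by (simp add: s_def)
  hence "s \<noteq> 0" using \<open>b \<noteq> 0\<close> by auto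
  hence "0 < s\<^sup>2 * (c + 2)" using c by simp
  moreover have "s\<^sup>2 * c - 2 * s * b = - (s\<^sup>2 * (c + 2))"
    by (simp add: b algebra_simps power2_eq_square)
  ultimately show False using nonneg[of s] by linarith
qed

text \<open>First-order optimality in one direction: the estimate is perturbed by \<open>s\<close>
  times the rank-one matrix \<open>v q^T\<close>, where \<open>v\<close> is the very sum claimed to
  vanish. The linear coefficient in \<open>s\<close> is then -2 times the squared norm of
  \<open>v\<close>.\<close>

lemma ols_normal_equation:
  fixes x :: "nat \<Rightarrow> real^'a" and u :: "nat \<Rightarrow> real^'b" and y :: "nat \<Rightarrow> real^'a"
  assumes "is_arg_min (ols_objective N y x u) (\<lambda>_. True) (A', B')"
  shows "(\<Sum>l = 1..N. (vstack (x l) (u l) \<bullet> q) *\<^sub>R (y l - A' *v x l - B' *v u l)) = 0"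
proof -
  obtain q1 q2 where q: "q = vstack q1 q2" using vstack_exhaust by blast
  define c r where "c l = vstack (x l) (u l) \<bullet> q" and "r l = y l - A' *v x l - B' *v u l" for l
  define v where "v = (\<Sum>l = 1..N. c l *\<^sub>R r l)"
  have "0 \<le> s\<^sup>2 * (\<Sum>l = 1..N. (c l)\<^sup>2 * (norm v)\<^sup>2) - 2 * s * (v \<bullet> v)" for s
  proof -
    define outer1 :: "real^'a^'a" where "outer1 = (\<chi> i j. v $ i * q1 $ j)"
    define outer2 :: "real^'b^'a" where "outer2 = (\<chi> i j. v $ i * q2 $ j)"
    have outer: "outer1 *v x l + outer2 *v u l = c l *\<^sub>R v" for l
    proof -
      have "outer1 *v p = (p \<bullet> q1) *\<^sub>R v" "outer2 *v p' = (p' \<bullet> q2) *\<^sub>R v" for p p'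
        by (simp_all add: vec_eq_iff outer1_def outer2_def matrix_vector_mult_def inner_vec_def
            sum_distrib_left mult_ac)
      thus ?thesis by (simp add: c_def q vstack_inner scaleR_add_left)
    qed
    have "ols_objective N y x u (A', B') \<le> ols_objective N y x u (A' + s *\<^sub>R outer1, B' + s *\<^sub>R outer2)"
      using assms by (simp add: is_arg_min_linorder)
    also have "ols_objective N y x u (A' + s *\<^sub>R outer1, B' + s *\<^sub>R outer2)
        = (\<Sum>l = 1..N. (norm (r l - (s * c l) *\<^sub>R v))\<^sup>2)"
      unfolding ols_objective_def prod.case
    proof (intro sum.cong refl arg_cong[where f = "\<lambda>v. (norm v)\<^sup>2"])
      fix l
      have "y l - (A' + s *\<^sub>R outer1) *v x l - (B' + s *\<^sub>R outer2) *v u l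
          = r l - s *\<^sub>R (outer1 *v x l + outer2 *v u l)"
        by (simp add: r_def matrix_vector_mult_add_rdistrib scaleR_matrix_vector_assoc[symmetric] algebra_simps)
      thus "y l - (A' + s *\<^sub>R outer1) *v x l - (B' + s *\<^sub>R outer2) *v u l = r l - (s * c l) *\<^sub>R v"
        by (simp add: outer)
    qed
    also have "\<dots> = (\<Sum>l = 1..N. (norm (r l))\<^sup>2) + s\<^sup>2 * (\<Sum>l = 1..N. (c l)\<^sup>2 * (norm v)\<^sup>2)
        - 2 * s * (\<Sum>l = 1..N. c l * (v \<bullet> r l))"
      unfolding sum_distrib_left sum.distrib[symmetric] sum_subtractf[symmetric]
    proof (intro sum.cong refl)
      fix l
      show "(norm (r l - (s * c l) *\<^sub>R v))\<^sup>2
          = (norm (r l))\<^sup>2 + s\<^sup>2 * ((c l)\<^sup>2 * (norm v)\<^sup>2) - 2 * s * (c l * (v \<bullet> r l))"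
        unfolding power2_norm_eq_inner
        by (simp add: inner_diff_left inner_diff_right inner_commute algebra_simps power2_eq_square)
    qed
    also have "(\<Sum>l = 1..N. c l * (v \<bullet> r l)) = v \<bullet> v"
      by (simp add: v_def inner_sum_right)
    finally show ?thesis by (simp add: ols_objective_def r_def)
  qed
  hence "v \<bullet> v = 0"
    by (rule nonneg_quadratic_linear_coeff[rotated]) (intro sum_nonneg, simp)
  thus ?thesis by (simp add: v_def c_def r_def)
qed

text \<open>Under the model the residual is \<open>w l\<close> minus the stacked error applied to
  the regressor, and the weighted sum of regressors is the Gram matrix applied to \<open>q\<close>;
  the normal equation rearranges accordingly.\<close>

lemma ols_error:
  fixes x :: "nat \<Rightarrow> real^'a" and u :: "nat \<Rightarrow> real^'b" and y :: "nat \<Rightarrow> real^'a"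
  assumes min: "is_arg_min (ols_objective N y x u) (\<lambda>_. True) (A', B')"
    and model: "\<And>l. l \<in> {1..N} \<Longrightarrow> y l = A *v x l + B *v u l + w l"
  shows "hstack (A' - A) (B' - B) *v (gram N x u *v q) = (\<Sum>l = 1..N. (vstack (x l) (u l) \<bullet> q) *\<^sub>R w l)"
proof -
  have "(\<Sum>l = 1..N. (vstack (x l) (u l) \<bullet> q) *\<^sub>R (y l - A' *v x l - B' *v u l))
      = (\<Sum>l = 1..N. (vstack (x l) (u l) \<bullet> q) *\<^sub>R w l
          - (vstack (x l) (u l) \<bullet> q) *\<^sub>R (hstack (A' - A) (B' - B) *v vstack (x l) (u l)))"
    by (intro sum.cong refl)
      (simp add: model hstack_mult_vstack matrix_vector_mult_diff_rdistrib scaleR_diff_right[symmetric])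
  also have "\<dots> = (\<Sum>l = 1..N. (vstack (x l) (u l) \<bullet> q) *\<^sub>R w l) - hstack (A' - A) (B' - B) *v (gram N x u *v q)"
    unfolding gram_mult sum_subtractf
    by (simp add: linear_sum[OF matrix_vector_mul_linear] matrix_vector_mult_scaleR)
  finally show ?thesis using ols_normal_equation[OF min, of q] by simp
qed

section \<open>Spectral norms of the error blocks\<close>

lemma norm_le_spectral_norm: "norm (X *v v) \<le> spectral_norm X * norm (v :: real^'n)"
  unfolding spectral_norm_def by (rule onorm[OF matrix_vector_mul_bounded_linear])

lemma spectral_norm_leI:
  assumes "\<And>v. norm (X *v v) \<le> b * norm v"
  shows "spectral_norm X \<le> b"
  unfolding spectral_norm_def using assms by (rule onorm_le)

text \<open>With \<open>q = matrix_inv G *v (transpose Q *v a)\<close> the left side of the assumed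
  bound is the norm of D a, and the inner product of q with G q is the quadratic form of Q G^{-1}
  Q^T at \<open>a\<close>, at most its spectral norm times |a|^2.\<close>

lemma spectral_norm_block_le:
  fixes E :: "real^'k^'m" and G :: "real^'k^'k" and Q :: "real^'k^'n" and D :: "real^'n^'m"
  assumes G: "invertible G" and C: "0 \<le> C"
    and D: "\<And>a. D *v a = E *v (transpose Q *v a)"
    and bound: "\<And>q. norm (E *v (G *v q)) \<le> C * sqrt (q \<bullet> (G *v q))"
  shows "spectral_norm D \<le> C * sqrt (spectral_norm (Q ** matrix_inv G ** transpose Q))"
proof (rule spectral_norm_leI)
  fix a
  define p q where "p = transpose Q *v a" and "q = matrix_inv G *v p"
  let ?s = "spectral_norm (Q ** matrix_inv G ** transpose Q)"
  have Gq: "G *v q = p"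
    unfolding q_def using G by (simp add: matrix_vector_mul_assoc matrix_inv_right)
  have "q \<bullet> p = a \<bullet> ((Q ** matrix_inv G ** transpose Q) *v a)"
    unfolding q_def p_def
    by (simp add: matrix_vector_mul_assoc[symmetric] inner_commute dot_lmul_matrix[symmetric] vector_transpose_matrix)
  also have "\<dots> \<le> norm a * (?s * norm a)"
    by (rule order.trans[OF norm_cauchy_schwarz mult_left_mono[OF norm_le_spectral_norm]]) simp
  finally have "q \<bullet> p \<le> ?s * (norm a)\<^sup>2" by (simp add: power2_eq_square mult_ac)
  hence "sqrt (q \<bullet> p) \<le> sqrt (?s * (norm a)\<^sup>2)" by simp
  also have "\<dots> = sqrt ?s * norm a" by (simp add: real_sqrt_mult)
  finally have "C * sqrt (q \<bullet> p) \<le> C * (sqrt ?s * norm a)" using C by (rule mult_left_mono)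
  moreover have "norm (D *v a) \<le> C * sqrt (q \<bullet> p)"
    using bound[of q] by (simp add: Gq D p_def)
  ultimately show "norm (D *v a) \<le> C * sqrt ?s * norm a" by (simp add: mult.assoc)
qed

section \<open>Measurability of matrix-valued functions\<close>

lemma borel_measurable_vecI:
  fixes f :: "'w \<Rightarrow> 'b::euclidean_space^'n"
  assumes "\<And>i. (\<lambda>\<omega>. f \<omega> $ i) \<in> borel_measurable M"
  shows "f \<in> borel_measurable M"
proof (subst borel_measurable_euclidean_space, rule ballI)
  fix e :: "'b^'n" assume "e \<in> Basis"
  then obtain i b where "e = axis i b" by (auto simp: Basis_vec_def)
  moreover note assms[of i, measurable]
  have "(\<lambda>\<omega>. f \<omega> $ i \<bullet> b) \<in> borel_measurable M" for b by measurable
  ultimately show "(\<lambda>\<omega>. f \<omega> \<bullet> e) \<in> borel_measurable M" by (simp add: inner_axis)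
qed

lemma borel_measurable_vec_nth [measurable]: "(\<lambda>v :: 'b::real_normed_vector^'n. v $ i) \<in> borel_measurable borel"
  by (intro borel_measurable_continuous_onI continuous_intros)

lemma borel_measurable_det [measurable (raw)]:
  fixes F :: "'w \<Rightarrow> real^'n^'n"
  assumes [measurable]: "F \<in> borel_measurable M"
  shows "(\<lambda>\<omega>. det (F \<omega>)) \<in> borel_measurable M"
  unfolding det_def by measurable

lemma borel_measurable_matrix_mult [measurable (raw)]:
  fixes F :: "'w \<Rightarrow> real^'n^'m" and H :: "'w \<Rightarrow> real^'k^'n"
  assumes [measurable]: "F \<in> borel_measurable M" "H \<in> borel_measurable M"
  shows "(\<lambda>\<omega>. F \<omega> ** H \<omega>) \<in> borel_measurable M"
  unfolding matrix_matrix_mult_def by (intro borel_measurable_vecI) simp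

text \<open>Sublevel sets are intersections of closed sets over the test vectors, hence closed
  although the intersection is uncountable.\<close>

lemma borel_measurable_spectral_norm [measurable]:
  "spectral_norm \<in> borel_measurable (borel :: (real^'n^'m) measure)"
proof (subst borel_measurable_iff_le, rule allI)
  fix r
  have "{X :: real^'n^'m. spectral_norm X \<le> r} = (\<Inter>v. {X. norm (X *v v) \<le> r * norm v})"
    by (auto intro: spectral_norm_leI order.trans[OF norm_le_spectral_norm mult_right_mono])
  moreover have "closed {X :: real^'n^'m. norm (X *v v) \<le> r * norm v}" for v
    unfolding matrix_vector_mult_def by (intro closed_Collect_le continuous_intros)
  ultimately show "{X \<in> space borel. spectral_norm (X :: real^'n^'m) \<le> r} \<in> sets borel"
    by (auto intro!: borel_closed closed_INT)
qed

text \<open>\<open>matrix_inv\<close> is given by choice; Cramer's rule exhibits its entries as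
  rational functions of those of \<open>G\<close>, from which measurability can be read off.\<close>

lemma matrix_inv_cramer:
  fixes G :: "real^'n^'n"
  assumes "det G \<noteq> 0"
  shows "matrix_inv G $ k $ j = det (\<chi> a b. if b = k then axis j 1 $ a else G $ a $ b) / det G"
proof -
  have "invertible G" using assms by (simp add: invertible_det_nz)
  hence "G *v (matrix_inv G *v axis j 1) = axis j 1"
    by (simp add: matrix_vector_mul_assoc matrix_inv_right)
  hence "matrix_inv G *v axis j 1 = (\<chi> k. det (\<chi> a b. if b = k then axis j 1 $ a else G $ a $ b) / det G)"
    using cramer[OF assms] by blast
  moreover have "(matrix_inv G *v axis j 1) $ k = matrix_inv G $ k $ j"
    by (simp add: matrix_vector_mul_component inner_axis)
  ultimately show ?thesis by simp
qed

section \<open>From fixed to random regressors\<close>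

text \<open>Conditioning on \<open>Y\<close>: by independence the joint law is a product, so Tonelli
  averages the section bounds over the law of \<open>Y\<close>, which has mass 1.\<close>

lemma (in prob_space) indep_section_bound:
  assumes X[measurable]: "X \<in> measurable M S" and Y[measurable]: "Y \<in> measurable M T"
    and indep: "\<And>E F. E \<in> sets S \<Longrightarrow> F \<in> sets T \<Longrightarrow>
      prob ((X -` E \<inter> space M) \<inter> (Y -` F \<inter> space M)) = prob (X -` E \<inter> space M) * prob (Y -` F \<inter> space M)"
    and H[measurable]: "H \<in> sets (S \<Otimes>\<^sub>M T)"
    and slice: "\<And>f. f \<in> space T \<Longrightarrow> emeasure (distr M S X) ((\<lambda>a. (a, f)) -` H) \<le> \<epsilon>"
  shows "emeasure M {\<omega> \<in> space M. (X \<omega>, Y \<omega>) \<in> H} \<le> \<epsilon>"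
proof -
  interpret S: prob_space "distr M S X" by (rule prob_space_distr[OF X])
  interpret T: prob_space "distr M T Y" by (rule prob_space_distr[OF Y])
  interpret pair_sigma_finite "distr M S X" "distr M T Y" ..
  have joint: "distr M S X \<Otimes>\<^sub>M distr M T Y = distr M (S \<Otimes>\<^sub>M T) (\<lambda>\<omega>. (X \<omega>, Y \<omega>))"
  proof (rule pair_measure_eqI)
    fix E F assume "E \<in> sets (distr M S X)" "F \<in> sets (distr M T Y)"
    hence EF[measurable]: "E \<in> sets S" "F \<in> sets T" by auto
    have "(\<lambda>\<omega>. (X \<omega>, Y \<omega>)) -` (E \<times> F) \<inter> space M = (X -` E \<inter> space M) \<inter> (Y -` F \<inter> space M)" by auto
    thus "emeasure (distr M S X) E * emeasure (distr M T Y) F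
        = emeasure (distr M (S \<Otimes>\<^sub>M T) (\<lambda>\<omega>. (X \<omega>, Y \<omega>))) (E \<times> F)"
      using indep[OF EF] by (simp add: emeasure_distr emeasure_eq_measure ennreal_mult)
  qed (auto intro: S.sigma_finite_measure_axioms T.sigma_finite_measure_axioms cong: sets_pair_measure_cong)
  have "emeasure M {\<omega> \<in> space M. (X \<omega>, Y \<omega>) \<in> H} = emeasure (distr M S X \<Otimes>\<^sub>M distr M T Y) H"
    unfolding joint by (subst emeasure_distr) (auto intro!: arg_cong[where f = "emeasure M"])
  also have "\<dots> = (\<integral>\<^sup>+f. emeasure (distr M S X) ((\<lambda>a. (a, f)) -` H) \<partial>distr M T Y)"
    by (rule emeasure_pair_measure_alt2) (use H in \<open>simp cong: sets_pair_measure_cong\<close>)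
  also have "\<dots> \<le> (\<integral>\<^sup>+f. \<epsilon> \<partial>distr M T Y)"
    by (intro nn_integral_mono slice) simp
  also have "\<dots> = \<epsilon>" using T.emeasure_space_1 by simp
  finally show ?thesis .
qed

text \<open>The noise condition is tested at \<open>v\<close>, the sum of the \<open>w l\<close>
  weighted by the inner products of the regressors with \<open>q\<close>; its double sum becomes
  |v|^2 / \<sigma>. Cancelling one factor |v| gives the bound that
  \<open>spectral_norm_block_le\<close> needs for both blocks.\<close>

lemma error_bound_if_not_noise_bad:
  fixes x :: "nat \<Rightarrow> real^'a" and u :: "nat \<Rightarrow> real^'b" and y w :: "nat \<Rightarrow> real^'a"
  assumes min: "is_arg_min (ols_objective N y x u) (\<lambda>_. True) (A', B')"
    and model: "\<And>l. l \<in> {1..N} \<Longrightarrow> y l = A *v x l + B *v u l + w l"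
    and \<sigma>: "0 < \<sigma>" and c: "0 \<le> c"
    and good: "\<not> (\<exists>p. noise_bad {1..N} c (\<lambda>l. vstack (x l) (u l)) (\<lambda>n\<in>{1..N} \<times> UNIV. w (fst n) $ snd n / \<sigma>) p)"
  shows "ereal (spectral_norm (A' - A)) \<le> error_bound (\<sigma> * c) Q\<^sub>A (gram N x u)"
    and "ereal (spectral_norm (B' - B)) \<le> error_bound (\<sigma> * c) Q\<^sub>B (gram N x u)"
proof -
  let ?z = "\<lambda>l. vstack (x l) (u l)" and ?E = "hstack (A' - A) (B' - B)" and ?G = "gram N x u"
  have bound: "norm (?E *v (?G *v q)) \<le> \<sigma> * c * sqrt (q \<bullet> (?G *v q))" for q
  proof -
    define v where "v = (\<Sum>l = 1..N. (?z l \<bullet> q) *\<^sub>R w l)"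
    have qGq: "q \<bullet> (?G *v q) = (\<Sum>l = 1..N. (?z l \<bullet> q)\<^sup>2)"
      by (simp add: gram_mult inner_sum_right inner_commute power2_eq_square)
    have "(\<Sum>l = 1..N. \<Sum>m\<in>UNIV. (?z l \<bullet> q) * v $ m * (w l $ m / \<sigma>)) = (v \<bullet> v) / \<sigma>"
    proof -
      have "(\<Sum>m\<in>UNIV. a * v $ m * (r $ m / \<sigma>)) = a * (v \<bullet> r) / \<sigma>" for a and r :: "real^'a"
        by (simp add: inner_vec_def sum_distrib_left sum_divide_distrib mult_ac)
      moreover have "v \<bullet> v = (\<Sum>l = 1..N. (?z l \<bullet> q) * (v \<bullet> w l))"
        by (subst (2) v_def) (simp add: inner_sum_right)
      ultimately show ?thesis by (simp add: sum_divide_distrib)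
    qed
    moreover have "(\<Sum>l = 1..N. \<Sum>m\<in>UNIV. (?z l \<bullet> q) * v $ m * (w l $ m / \<sigma>))
        \<le> c * sqrt (\<Sum>l = 1..N. (?z l \<bullet> q)\<^sup>2) * norm v"
      using good by (simp add: noise_bad_def not_less)
    ultimately have "(v \<bullet> v) / \<sigma> \<le> c * sqrt (q \<bullet> (?G *v q)) * norm v" by (simp add: qGq)
    hence "norm v * norm v \<le> (\<sigma> * c * sqrt (q \<bullet> (?G *v q))) * norm v"
      using \<sigma> by (simp add: pos_divide_le_eq mult_ac power2_norm_eq_inner[symmetric] power2_eq_square)
    moreover have "0 \<le> \<sigma> * c * sqrt (q \<bullet> (?G *v q))" using \<sigma> c by (simp add: qGq sum_nonneg)
    ultimately have "norm v \<le> \<sigma> * c * sqrt (q \<bullet> (?G *v q))"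
      by (cases "v = 0") auto
    moreover have "?E *v (?G *v q) = v"
      unfolding v_def by (rule ols_error[OF min model])
    ultimately show ?thesis by simp
  qed
  have DA: "(A' - A) *v a = ?E *v (transpose Q\<^sub>A *v a)" for a
    unfolding transpose_Q\<^sub>A hstack_mult_vstack by simp
  have DB: "(B' - B) *v b = ?E *v (transpose Q\<^sub>B *v b)" for b
    unfolding transpose_Q\<^sub>B hstack_mult_vstack by simp
  show "ereal (spectral_norm (A' - A)) \<le> error_bound (\<sigma> * c) Q\<^sub>A ?G"
    using spectral_norm_block_le[OF _ _ DA bound] \<sigma> c by (simp add: error_bound_def)
  show "ereal (spectral_norm (B' - B)) \<le> error_bound (\<sigma> * c) Q\<^sub>B ?G"
    using spectral_norm_block_le[OF _ _ DB bound] \<sigma> c by (simp add: error_bound_def)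
qed

lemma borel_measurable_vstack [measurable (raw)]:
  fixes f :: "'w \<Rightarrow> real^'a" and g :: "'w \<Rightarrow> real^'b"
  assumes [measurable]: "f \<in> borel_measurable M" "g \<in> borel_measurable M"
  shows "(\<lambda>\<omega>. vstack (f \<omega>) (g \<omega>)) \<in> borel_measurable M"
proof (rule borel_measurable_vecI)
  show "(\<lambda>\<omega>. vstack (f \<omega>) (g \<omega>) $ k) \<in> borel_measurable M" for k
    by (cases k) simp_all
qed

text \<open>On singular designs the minimizer, and hence \<open>E\<close>, need not depend measurably on \<open>\<omega>\<close>, but there the
  bound is infinite.\<close>

lemma measurable_error_bound:
  fixes x :: "nat \<Rightarrow> 'w \<Rightarrow> real^'a" and u :: "nat \<Rightarrow> 'w \<Rightarrow> real^'b" and w :: "nat \<Rightarrow> 'w \<Rightarrow> real^'m"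
    and E :: "'w \<Rightarrow> real^('a + 'b)^'m" and Q :: "real^('a + 'b)^'n" and D :: "'w \<Rightarrow> real^'n^'m"
  assumes xuw: "\<And>l. l \<in> {1..N} \<Longrightarrow> x l \<in> borel_measurable M" "\<And>l. l \<in> {1..N} \<Longrightarrow> u l \<in> borel_measurable M"
      "\<And>l. l \<in> {1..N} \<Longrightarrow> w l \<in> borel_measurable M"
    and E: "\<And>\<omega> q. \<omega> \<in> space M \<Longrightarrow> E \<omega> *v (gram N (\<lambda>l. x l \<omega>) (\<lambda>l. u l \<omega>) *v q)
          = (\<Sum>l = 1..N. (vstack (x l \<omega>) (u l \<omega>) \<bullet> q) *\<^sub>R w l \<omega>)"
    and D: "\<And>\<omega> a. \<omega> \<in> space M \<Longrightarrow> D \<omega> *v a = E \<omega> *v (transpose Q *v a)"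
  shows "{\<omega> \<in> space M. ereal (spectral_norm (D \<omega>)) \<le> error_bound c Q (gram N (\<lambda>l. x l \<omega>) (\<lambda>l. u l \<omega>))} \<in> sets M"
proof -
  note xuw[measurable]
  define G where "G \<omega> = gram N (\<lambda>l. x l \<omega>) (\<lambda>l. u l \<omega>)" for \<omega>
  have G[measurable]: "G \<in> borel_measurable M"
    by (intro borel_measurable_vecI) (simp add: G_def gram_nth)
  \<comment> \<open>Cramer's formula is measurable on the whole space. Where the determinant is 0
    its entries are 0 by the convention for division, and it is compared with the inverse only
    elsewhere.\<close>
  define H where "H \<omega> = (\<chi> k j. det (\<chi> a b. if b = k then axis j 1 $ a else G \<omega> $ a $ b) / det (G \<omega>))" for \<omega>
  have H[measurable]: "H \<in> borel_measurable M"
  proof (intro borel_measurable_vecI)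
    fix k j
    have "(\<lambda>\<omega>. (\<chi> a b. if b = k then axis j 1 $ a else G \<omega> $ a $ b)) \<in> borel_measurable M"
      by (intro borel_measurable_vecI) simp
    thus "(\<lambda>\<omega>. H \<omega> $ k $ j) \<in> borel_measurable M" unfolding H_def by simp
  qed
  have H_inv: "matrix_inv (G \<omega>) = H \<omega>" if "det (G \<omega>) \<noteq> 0" for \<omega>
    using that by (simp add: vec_eq_iff H_def matrix_inv_cramer)
  \<comment> \<open>Column \<open>j\<close> arises by inserting
    \<open>q = H \<omega> *v (transpose Q *v axis j 1)\<close> into the error identity; this is a
    measurable stand-in for \<open>D\<close> on nonsingular designs.\<close>
  define D' where "D' \<omega> = (\<chi> i j. \<Sum>l = 1..N. (vstack (x l \<omega>) (u l \<omega>) \<bullet> (H \<omega> *v (transpose Q *v axis j 1))) * w l \<omega> $ i)"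
    for \<omega>
  have "(\<lambda>\<omega>. H \<omega> *v v) \<in> borel_measurable M" for v
    by (intro borel_measurable_vecI) (simp add: matrix_vector_mult_def)
  hence [measurable]: "D' \<in> borel_measurable M"
    by (intro borel_measurable_vecI) (simp add: D'_def)
  have D_eq: "D \<omega> = D' \<omega>" if "\<omega> \<in> space M" "det (G \<omega>) \<noteq> 0" for \<omega>
  proof -
    have "D \<omega> $ i $ j = D' \<omega> $ i $ j" for i j
    proof -
      define p where "p = transpose Q *v axis j 1"
      have "G \<omega> *v (H \<omega> *v p) = p"
        using that(2) H_inv[of \<omega>] by (metis matrix_vector_mul_assoc matrix_inv_right invertible_det_nz matrix_vector_mul_lid)
      hence "D \<omega> *v axis j 1 = (\<Sum>l = 1..N. (vstack (x l \<omega>) (u l \<omega>) \<bullet> (H \<omega> *v p)) *\<^sub>R w l \<omega>)"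
        using E[OF that(1), of "H \<omega> *v p"] D[OF that(1), of "axis j 1"] by (simp add: G_def p_def)
      moreover have "(D \<omega> *v axis j 1) $ i = D \<omega> $ i $ j"
        by (simp add: matrix_vector_mul_component inner_axis)
      ultimately show ?thesis by (simp add: D'_def p_def)
    qed
    thus ?thesis by (simp add: vec_eq_iff)
  qed
  have "{\<omega> \<in> space M. ereal (spectral_norm (D \<omega>)) \<le> error_bound c Q (gram N (\<lambda>l. x l \<omega>) (\<lambda>l. u l \<omega>))}
      = {\<omega> \<in> space M. det (G \<omega>) = 0 \<or>
          spectral_norm (D' \<omega>) \<le> c * sqrt (spectral_norm (Q ** H \<omega> ** transpose Q))}"
  proof (intro Collect_cong conj_cong refl)
    fix \<omega> assume \<omega>: "\<omega> \<in> space M"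
    show "ereal (spectral_norm (D \<omega>)) \<le> error_bound c Q (gram N (\<lambda>l. x l \<omega>) (\<lambda>l. u l \<omega>)) \<longleftrightarrow>
        det (G \<omega>) = 0 \<or> spectral_norm (D' \<omega>) \<le> c * sqrt (spectral_norm (Q ** H \<omega> ** transpose Q))"
      by (cases "det (G \<omega>) = 0")
        (simp_all add: error_bound_def invertible_det_nz G_def[symmetric] D_eq[OF \<omega>] H_inv)
  qed
  also have "\<dots> \<in> sets M" by measurable
  finally show ?thesis .
qed

section \<open>High-probability bounds for the least-squares estimate\<close>

theorem corollary2:
  fixes P :: "'w measure"
    and A :: "real^'nx^'nx" and B :: "real^'nu^'nx"
    and \<sigma> \<delta> C :: real and N :: nat
    and y x w :: "nat \<Rightarrow> 'w \<Rightarrow> real^'nx" and u :: "nat \<Rightarrow> 'w \<Rightarrow> real^'nu"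
    and Ahat :: "'w \<Rightarrow> real^'nx^'nx" and Bhat :: "'w \<Rightarrow> real^'nu^'nx"
  assumes P: "prob_space P"
    and \<sigma>: "\<sigma> > 0"
    and samples_indep:
      "prob_space.indep_vars P (\<lambda>_. borel) (\<lambda>l \<omega>. (y l \<omega>, x l \<omega>, u l \<omega>)) {1..N}"
    and model: "\<And>l \<omega>. l \<in> {1..N} \<Longrightarrow> \<omega> \<in> space P \<Longrightarrow> y l \<omega> = A *v x l \<omega> + B *v u l \<omega> + w l \<omega>"
    and noise_indep: "prob_space.indep_vars P (\<lambda>_. borel) w {1..N}"
    and noise_normal:
      "\<And>l. l \<in> {1..N} \<Longrightarrow> distributed P lborel (w l)
         (\<lambda>v. ennreal (mv_normal_density 0 (\<sigma>\<^sup>2 *\<^sub>R mat 1) v))"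
    and noise_indep_of_inputs:
      "indep_rvs P
         (Pi\<^sub>M {1..N} (\<lambda>_. borel)) (\<lambda>\<omega>. \<lambda>l\<in>{1..N}. w l \<omega>)
         (Pi\<^sub>M {1..N} (\<lambda>_. borel)) (\<lambda>\<omega>. \<lambda>l\<in>{1..N}. (x l \<omega>, u l \<omega>))"
    and estimate:
      "\<And>\<omega>. \<omega> \<in> space P \<Longrightarrow>
         is_arg_min (ols_objective N (\<lambda>l. y l \<omega>) (\<lambda>l. x l \<omega>) (\<lambda>l. u l \<omega>)) (\<lambda>_. True)
           (Ahat \<omega>, Bhat \<omega>)"
    and \<delta>: "0 < \<delta>" "\<delta> < 1"
    and N: "N \<ge> CARD('nx) + CARD('nu)"
    and C: "C = \<sigma> * (sqrt (real (CARD('nx) + CARD('nu))) + sqrt (real CARD('nx))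
                      + sqrt (2 * ln (1 / \<delta>)))"
  shows "measure P {\<omega> \<in> space P.
           ereal (spectral_norm (Ahat \<omega> - A))
             \<le> error_bound C Q\<^sub>A (gram N (\<lambda>l. x l \<omega>) (\<lambda>l. u l \<omega>)) \<and>
           ereal (spectral_norm (Bhat \<omega> - B))
             \<le> error_bound C Q\<^sub>B (gram N (\<lambda>l. x l \<omega>) (\<lambda>l. u l \<omega>))} \<ge> 1 - \<delta>"
proof -
  interpret prob_space P by (rule P)
  let ?L = "{1..N}"
  \<comment> \<open>The product formula for independent samples is applied to a nonempty index set,
    which the lower bound on \<open>N\<close> provides.\<close>
  have "1 \<le> N" using N zero_less_card_finite[where 'a='nx] by linarith
  hence "?L \<noteq> {}" by simp
  \<comment> \<open>Chosen so that the Gaussian tail exp (- t^2 / 2) equals \<delta>.\<close>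
  define t where "t = sqrt (2 * ln (1 / \<delta>))"
  have t: "0 \<le> t" "exp (- t\<^sup>2 / 2) = \<delta>" using \<delta> by (auto simp: t_def ln_div)
  define c where "c = sqrt (real CARD('nx + 'nu)) + sqrt (real CARD('nx)) + t"
  have c: "0 \<le> c" using t by (simp add: c_def)
  have C: "C = \<sigma> * c" by (simp add: C c_def t_def)

  have wm: "w l \<in> borel_measurable P" if "l \<in> ?L" for l
    using noise_indep that by (auto simp: indep_vars_def)
  have "(\<lambda>\<omega>. (y l \<omega>, x l \<omega>, u l \<omega>)) \<in> borel_measurable P" if "l \<in> ?L" for l
    using samples_indep that by (auto simp: indep_vars_def)
  hence yxu: "(\<lambda>\<omega>. (y l \<omega>, x l \<omega>, u l \<omega>)) \<in> measurable P (borel \<Otimes>\<^sub>M borel \<Otimes>\<^sub>M borel)" if "l \<in> ?L" for l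
    using that by (simp add: borel_prod)
  have xm: "x l \<in> borel_measurable P" if "l \<in> ?L" for l
    using measurable_compose[OF yxu[OF that], of "\<lambda>p. fst (snd p)" borel] by simp
  have um: "u l \<in> borel_measurable P" if "l \<in> ?L" for l
    using measurable_compose[OF yxu[OF that], of "\<lambda>p. snd (snd p)" borel] by simp

  define \<mu> where "\<mu> = Pi\<^sub>M (?L \<times> (UNIV :: 'nx set)) (\<lambda>_. std_gauss)"
  define T where "T = Pi\<^sub>M ?L (\<lambda>_. borel :: ((real^'nx) \<times> (real^'nu)) measure)"
  define W where "W \<omega> = (\<lambda>l\<in>?L. w l \<omega>)" for \<omega>
  define Y where "Y \<omega> = (\<lambda>l\<in>?L. (x l \<omega>, u l \<omega>))" for \<omega>
  define \<xi> where "\<xi> \<omega> = (\<lambda>n\<in>?L \<times> UNIV. w (fst n) \<omega> $ snd n / \<sigma>)" for \<omega>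
  \<comment> \<open>\<open>g\<close> exhibits the standardised noise \<xi> as a measurable function
    of \<open>W\<close>, so that \<xi> inherits independence from the regressors
    \<open>Y\<close>.\<close>
  define g where "g f = (\<lambda>n\<in>?L \<times> UNIV. f (fst n) $ snd n / \<sigma>)" for f :: "nat \<Rightarrow> real^'nx"
  have \<xi>_g: "\<xi> = (\<lambda>\<omega>. g (W \<omega>))"
    by (auto simp: \<xi>_def g_def W_def fun_eq_iff)
  have WY: "W \<in> measurable P (Pi\<^sub>M ?L (\<lambda>_. borel))" "Y \<in> measurable P T"
    and indep: "indep_set {W -` E \<inter> space P |E. E \<in> sets (Pi\<^sub>M ?L (\<lambda>_. borel))} {Y -` F \<inter> space P |F. F \<in> sets T}"
    using noise_indep_of_inputs unfolding indep_rvs_def W_def[symmetric] Y_def[symmetric] T_def[symmetric]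
    by auto
  have g: "g \<in> measurable (Pi\<^sub>M ?L (\<lambda>_. borel)) \<mu>"
    unfolding \<mu>_def g_def
  proof (intro measurable_restrict)
    fix n :: "nat \<times> 'nx" assume "n \<in> ?L \<times> UNIV"
    hence [measurable]: "(\<lambda>f. f (fst n)) \<in> borel_measurable (Pi\<^sub>M ?L (\<lambda>_. borel))"
      by (intro measurable_component_singleton) auto
    show "(\<lambda>f. f (fst n) $ snd n / \<sigma>) \<in> measurable (Pi\<^sub>M ?L (\<lambda>_. borel)) std_gauss" by measurable
  qed
  have \<xi>[measurable]: "\<xi> \<in> measurable P \<mu>"
    unfolding \<xi>_g by (rule measurable_compose[OF WY(1) g])
  have indep': "prob ((\<xi> -` E \<inter> space P) \<inter> (Y -` F \<inter> space P)) = prob (\<xi> -` E \<inter> space P) * prob (Y -` F \<inter> space P)"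
    if EF: "E \<in> sets \<mu>" "F \<in> sets T" for E F
  proof -
    have "\<xi> -` E \<inter> space P = W -` (g -` E \<inter> space (Pi\<^sub>M ?L (\<lambda>_. borel))) \<inter> space P"
      using measurable_space[OF WY(1)] by (auto simp: \<xi>_g)
    thus ?thesis using EF measurable_sets[OF g EF(1)] by (intro indep_setD[OF indep]) blast+
  qed

  obtain D :: "((real^('nx + 'nu)) \<times> (real^'nx)) set" where D: "countable D"
    "\<And>X. open X \<Longrightarrow> X \<noteq> {} \<Longrightarrow> \<exists>d\<in>D. d \<in> X" by (rule countable_dense_setE) blast
  define z where "z f l = vstack (fst (f l)) (snd (f l))" for f :: "nat \<Rightarrow> (real^'nx) \<times> (real^'nu)" and l
  have dense: "(\<exists>p. noise_bad ?L c (z f) e p) \<longleftrightarrow> (\<exists>p\<in>D. noise_bad ?L c (z f) e p)"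
    for f and e :: "nat \<times> 'nx \<Rightarrow> real"
    by (rule noise_bad_dense) (rule D(2))
  \<comment> \<open>The bad event as a set of pairs of noise and design: its sections at fixed
    designs are the events of \<open>noise_bad_tail\<close>, and the countable set \<open>D\<close>
    makes it measurable.\<close>
  define H where "H = {a \<in> space (\<mu> \<Otimes>\<^sub>M T). \<exists>p. noise_bad ?L c (z (snd a)) (fst a) p}"
  have H: "H \<in> sets (\<mu> \<Otimes>\<^sub>M T)"
  proof -
    have [measurable]: "(\<lambda>e. e (l, m)) \<in> borel_measurable \<mu>" if "l \<in> ?L" for l m
      using integrable_std_gauss_component[of "?L \<times> (UNIV :: 'nx set)" "(l, m)"] that
      unfolding \<mu>_def by auto
    have fl: "(\<lambda>f. f l) \<in> measurable T (borel \<Otimes>\<^sub>M borel)" if "l \<in> ?L" for l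
      unfolding T_def borel_prod using that by (rule measurable_component_singleton)
    have [measurable]: "(\<lambda>f. z f l) \<in> borel_measurable T" if "l \<in> ?L" for l
      unfolding z_def by (intro borel_measurable_vstack measurable_compose[OF fl[OF that]]) simp_all
    have "{a \<in> space (\<mu> \<Otimes>\<^sub>M T). noise_bad ?L c (z (snd a)) (fst a) p} \<in> sets (\<mu> \<Otimes>\<^sub>M T)" for p
      unfolding noise_bad_def split_beta by measurable
    thus ?thesis unfolding H_def dense by (intro sets.sets_Collect_countable_Ex' D(1))
  qed
  have "emeasure P {\<omega> \<in> space P. (\<xi> \<omega>, Y \<omega>) \<in> H} \<le> ennreal \<delta>"
  proof (rule indep_section_bound[OF \<xi> WY(2) indep' H])
    fix f assume f: "f \<in> space T"
    have law: "distr P \<mu> \<xi> = \<mu>"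
      unfolding \<mu>_def \<xi>_def
      by (rule distr_normalized_noise[OF _ \<open>?L \<noteq> {}\<close> \<sigma> noise_indep noise_normal]) auto
    interpret M: prob_space \<mu> unfolding \<mu>_def by (intro prob_space_PiM prob_space_std_gauss)
    have "(\<lambda>a. (a, f)) -` H = {e \<in> space \<mu>. \<exists>p. noise_bad ?L c (z f) e p}"
      using f by (auto simp: H_def space_pair_measure)
    moreover have "measure \<mu> {e \<in> space \<mu>. \<exists>p. noise_bad ?L c (z f) e p} \<le> \<delta>"
      using noise_bad_tail[of ?L t "z f", where 'm='nx, folded c_def \<mu>_def] t by simp
    ultimately show "emeasure (distr P \<mu> \<xi>) ((\<lambda>a. (a, f)) -` H) \<le> ennreal \<delta>"
      unfolding law by (simp add: M.emeasure_eq_measure ennreal_leI)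
  qed
  hence bad: "prob {\<omega> \<in> space P. (\<xi> \<omega>, Y \<omega>) \<in> H} \<le> \<delta>"
    using \<delta> by (simp add: emeasure_eq_measure)

  let ?S = "{\<omega> \<in> space P.
      ereal (spectral_norm (Ahat \<omega> - A)) \<le> error_bound C Q\<^sub>A (gram N (\<lambda>l. x l \<omega>) (\<lambda>l. u l \<omega>)) \<and>
      ereal (spectral_norm (Bhat \<omega> - B)) \<le> error_bound C Q\<^sub>B (gram N (\<lambda>l. x l \<omega>) (\<lambda>l. u l \<omega>))}"
  have err: "hstack (Ahat \<omega> - A) (Bhat \<omega> - B) *v (gram N (\<lambda>l. x l \<omega>) (\<lambda>l. u l \<omega>) *v q)
      = (\<Sum>l = 1..N. (vstack (x l \<omega>) (u l \<omega>) \<bullet> q) *\<^sub>R w l \<omega>)" if "\<omega> \<in> space P" for \<omega> q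
    using that by (intro ols_error[OF estimate model])
  \<comment> \<open>\<open>measure\<close> is 0 on nonmeasurable sets, so measurability has to
    precede the lower bound by monotonicity.\<close>
  have S: "?S \<in> sets P"
  proof (intro sets.sets_Collect_conj)
    show "{\<omega> \<in> space P. ereal (spectral_norm (Ahat \<omega> - A)) \<le> error_bound C Q\<^sub>A (gram N (\<lambda>l. x l \<omega>) (\<lambda>l. u l \<omega>))} \<in> sets P"
      by (rule measurable_error_bound[OF xm um wm err]) (simp_all add: transpose_Q\<^sub>A hstack_mult_vstack del: transpose_matrix_vector)
    show "{\<omega> \<in> space P. ereal (spectral_norm (Bhat \<omega> - B)) \<le> error_bound C Q\<^sub>B (gram N (\<lambda>l. x l \<omega>) (\<lambda>l. u l \<omega>))} \<in> sets P"
      by (rule measurable_error_bound[OF xm um wm err]) (simp_all add: transpose_Q\<^sub>B hstack_mult_vstack del: transpose_matrix_vector)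
  qed
  have zY: "noise_bad ?L c (z (Y \<omega>)) e p = noise_bad ?L c (\<lambda>l. vstack (x l \<omega>) (u l \<omega>)) e p" for \<omega> e p
    by (simp add: noise_bad_def z_def Y_def split_beta)
  \<comment> \<open>Off the bad event both bounds hold pointwise, so the claimed event contains a
    complement of probability at least 1 - \<delta>.\<close>
  have "space P - {\<omega> \<in> space P. (\<xi> \<omega>, Y \<omega>) \<in> H} \<subseteq> ?S"
  proof
    fix \<omega> assume \<omega>: "\<omega> \<in> space P - {\<omega> \<in> space P. (\<xi> \<omega>, Y \<omega>) \<in> H}"
    hence "\<not> (\<exists>p. noise_bad ?L c (z (Y \<omega>)) (\<xi> \<omega>) p)"
      using measurable_space[OF \<xi>, of \<omega>] measurable_space[OF WY(2), of \<omega>]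
      by (simp add: H_def space_pair_measure)
    hence "\<not> (\<exists>p. noise_bad ?L c (\<lambda>l. vstack (x l \<omega>) (u l \<omega>)) (\<xi> \<omega>) p)"
      unfolding zY .
    thus "\<omega> \<in> ?S"
      using \<omega> error_bound_if_not_noise_bad[OF estimate model \<sigma> c, of \<omega>] by (simp add: C \<xi>_def)
  qed
  hence "prob (space P - {\<omega> \<in> space P. (\<xi> \<omega>, Y \<omega>) \<in> H}) \<le> prob ?S"
    using S by (rule finite_measure_mono)
  moreover have "{\<omega> \<in> space P. (\<xi> \<omega>, Y \<omega>) \<in> H} \<in> sets P"
    using H WY(2) by measurable
  ultimately show ?thesis using bad by (simp add: prob_compl)
qed

end
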